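(* Let $d\in\{-2,-7,-11,-15\}$ and $R=\mathcal{O}_{\mathbb{Q}(\sqrt{d})}$. Every connected cyclotomic $\mathcal{L}$-graph over $R$ is contained in a maximal connected cyclotomic $\mathcal{L}$-graph over $R$.
   Context: For $R=\mathcal{O}_{\mathbb{Q}(\sqrt{d})}$ and $n\ge1$ let $\mathcal{L}_n=\{x\in R: x\bar x=n\}$, $\mathcal{L}=\{0\}\cup\mathcal{L}_1\cup\mathcal{L}_2\cup\mathcal{L}_3\cup\mathcal{L}_4$. A (charged) $\mathcal{L}$-graph on $n$ vertices is identified with an $n\times n$ Hermitian matrix $A$ whose diagonal entries lie in $\{0,1,-1\}$ and whose off-diagonal entries lie in $\mathcal{L}$. It is cyclotomic if all eigenvalues of $A$ lie in $[-2,2]$, connected if $A$ is not permutation-similar to a block diagonal matrix with more than one block. $H$ is contained in $G$ if the matrix of $H$ is obtained (up to simultaneous permutation of rows and columns) from that of $G$ by deleting some rows and the corresponding columns. A connected cyclotomic $\mathcal{L}$-graph is maximal if it is not contained in a strictly larger connected cyclotomic $\mathcal{L}$-graph. *)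

theory Defs
  imports
    Complex_Main
    "HOL-Combinatorics.Permutations"
    "Jordan_Normal_Form.Schur_Decomposition"
    "Jordan_Normal_Form.DL_Submatrix"
begin

definition quadratic_field :: "int \<Rightarrow> complex set" where
  "quadratic_field d =
     {of_rat a + of_rat b * csqrt (of_int d) | (a :: rat) (b :: rat). True}"

definition ring_of_integers :: "int \<Rightarrow> complex set" where
  "ring_of_integers d = {x \<in> quadratic_field d. algebraic_int x}"

definition norm_level :: "int \<Rightarrow> nat \<Rightarrow> complex set" where
  "norm_level d n = {x \<in> ring_of_integers d. x * cnj x = of_nat n}"

definition label_set :: "int \<Rightarrow> complex set" where
  "label_set d =
     {0} \<union> norm_level d 1 \<union> norm_level d 2 \<union> norm_level d 3 \<union> norm_level d 4"

definition hermitian_mat :: "complex mat \<Rightarrow> bool" where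
  "hermitian_mat A \<longleftrightarrow> square_mat A \<and> mat_adjoint A = A"

text \<open>Graphs are required to have at least one vertex.\<close>

definition charged_graph :: "int \<Rightarrow> complex mat \<Rightarrow> bool" where
  "charged_graph d A \<longleftrightarrow>
     hermitian_mat A \<and> dim_row A \<ge> 1 \<and>
     (\<forall>i < dim_row A. A $$ (i, i) \<in> {0, 1, -1}) \<and>
     (\<forall>i < dim_row A. \<forall>j < dim_row A. i \<noteq> j \<longrightarrow> A $$ (i, j) \<in> label_set d)"

definition cyclotomic :: "complex mat \<Rightarrow> bool" where
  "cyclotomic A \<longleftrightarrow> (\<forall>k. eigenvalue A k \<longrightarrow> k \<in> complex_of_real ` {-2..2})"

text \<open>Simultaneous permutation of the rows and columns of a square matrix.\<close>

definition permutation_similar :: "'a mat \<Rightarrow> 'a mat \<Rightarrow> bool" where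
  "permutation_similar A B \<longleftrightarrow>
     square_mat A \<and>
     (\<exists>p. p permutes {..<dim_row A} \<and>
          B = mat (dim_row A) (dim_row A) (\<lambda>(i, j). A $$ (p i, p j)))"

text \<open>
  The blocks must be nonempty: otherwise a \<open>0 \<times> 0\<close> block could be adjoined to any matrix,
  and nothing would be connected.
\<close>

definition connected_mat :: "complex mat \<Rightarrow> bool" where
  "connected_mat A \<longleftrightarrow>
     \<not> (\<exists>Bs. length Bs > 1 \<and> (\<forall>B \<in> set Bs. square_mat B \<and> dim_row B \<ge> 1) \<and>
             permutation_similar A (diag_block_mat Bs))"

text \<open>The set \<open>I\<close> consists of the indices that are kept; no index need be deleted.\<close>

definition contained_in :: "'a mat \<Rightarrow> 'a mat \<Rightarrow> bool" where
  "contained_in H G \<longleftrightarrow>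
     (\<exists>I \<subseteq> {..<dim_row G}. permutation_similar (submatrix G I I) H)"

definition connected_cyclotomic_graph :: "int \<Rightarrow> complex mat \<Rightarrow> bool" where
  "connected_cyclotomic_graph d A \<longleftrightarrow>
     charged_graph d A \<and> connected_mat A \<and> cyclotomic A"

definition maximal_graph :: "int \<Rightarrow> complex mat \<Rightarrow> bool" where
  "maximal_graph d A \<longleftrightarrow>
     connected_cyclotomic_graph d A \<and>
     \<not> (\<exists>B. connected_cyclotomic_graph d B \<and> dim_row B > dim_row A \<and> contained_in A B)"

end

theory Submission
  imports Defs "Jordan_Normal_Form.Spectral_Radius"
begin

text \<open>
  If \<open>A\<close> lies in no maximal graph, then it lies in connected cyclotomic graphs \<open>G\<close> of arbitrarily
  large size. Rows of \<open>G\<close> have weight at most 4, so \<open>G\<close> contains long geodesics issuing from \<open>A\<close>;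
  away from its ends such a path is uncharged with edges of weight 1. Cut the path after ten vertices
  and attach to its end \<open>r\<close> a \<^emph>\<open>cap\<close>: two vertices \<open>u\<close>, \<open>v\<close> of charge 1, joined by an edge 1, with
  \<open>a r u = 1\<close> and \<open>a r v = - 1\<close>. Here \<open>u + v\<close> splits off as an eigenvector for 2, and \<open>(u - v) / 2\<close> is a
  limit of slowly decaying vectors on the discarded part of the path. As only finitely many matrices
  can remain after cutting, one of them occurs for arbitrarily long paths, and in the limit its
  capped version is cyclotomic.

  Doing this twice gives a graph with two caps which contains \<open>A\<close>. But a connected cyclotomic graph
  with two caps is bounded by the distance \<open>m\<close> of the caps: along a shortest path between them, the
  vector of entries of modulus 1, corrected at the caps, lies in the kernels of both \<open>2 - A\<close> and
  \<open>2 + A\<close>. The kernel equations force every neighbour of the path to be adjacent to two path vertices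
  at distance 2; exchanging it with the vertex between them gives another shortest path, so that
  every vertex is adjacent to the first one, and there are at most \<open>5 m + 7\<close> vertices.
\<close>

section \<open>Positive semidefinite Hermitian forms\<close>

text \<open>Uncharged paths of weight 1 are cyclotomic at every length, and so are such paths with
  one cap. So a size bound can be expected only after both ends have been closed off. A single end
  vertex of charge 1 would not close an end: it has the value 1 in \<open>2 - A\<close> but 3 in
  \<open>2 + A\<close>, which leaves slack. A cap, once \<open>u + v\<close> is split off, has the
  value 1 in both forms, the infimum of the energies of a half-infinite tail. Hence it can replace
  the tail, and two caps make both forms degenerate at once. Both degeneracies matter: together they
  put the second attachment of an outside vertex at the same parity, hence at distance exactly 2,
  and this allows the exchange along a shortest path.

  The entries of a cap are 1 and -1, which lie in \<open>label_set d\<close>; that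
  \<open>label_set d\<close> is finite is what leaves only finitely many cut matrices. Eigenvalues
  appear only at the interface: the arguments use nonnegativity of the forms of \<open>2 + A\<close>
  and \<open>2 - A\<close>, which passes to subgraphs and to limits.\<close>

definition hform :: "'i set \<Rightarrow> ('i \<Rightarrow> 'i \<Rightarrow> complex) \<Rightarrow> ('i \<Rightarrow> complex) \<Rightarrow> complex" where
  "hform I b x = (\<Sum>i\<in>I. \<Sum>j\<in>I. cnj (x i) * b i j * x j)"

definition psd :: "'i set \<Rightarrow> ('i \<Rightarrow> 'i \<Rightarrow> complex) \<Rightarrow> bool" where
  "psd I b \<longleftrightarrow> (\<forall>i\<in>I. \<forall>j\<in>I. b j i = cnj (b i j)) \<and> (\<forall>x. 0 \<le> Re (hform I b x))"

lemma psd_herm: "psd I b \<Longrightarrow> i \<in> I \<Longrightarrow> j \<in> I \<Longrightarrow> b j i = cnj (b i j)"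
  and psd_nonneg: "psd I b \<Longrightarrow> 0 \<le> Re (hform I b x)"
  unfolding psd_def by blast+

lemma hform_cong:
  assumes "\<And>i j. i \<in> I \<Longrightarrow> j \<in> I \<Longrightarrow> b i j = b' i j" and "\<And>i. i \<in> I \<Longrightarrow> x i = x' i"
  shows "hform I b x = hform I b' x'"
  unfolding hform_def by (intro sum.cong refl) (simp add: assms)

lemma psd_cong:
  assumes "\<And>i j. i \<in> I \<Longrightarrow> j \<in> I \<Longrightarrow> b i j = b' i j"
  shows "psd I b \<longleftrightarrow> psd I b'"
  using hform_cong[of I b b'] assms unfolding psd_def by simp

lemma hform_pullback:
  assumes "finite V" "finite I" "s ` I \<subseteq> V"
  shows "hform V b (\<lambda>v. \<Sum>i\<in>I. if s i = v then c i else 0)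
       = hform I (\<lambda>i j. b (s i) (s j)) c"
proof -
  let ?x = "\<lambda>v. \<Sum>i\<in>I. if s i = v then c i else 0"
  have lin: "(\<Sum>v\<in>V. g v * ?x v) = (\<Sum>i\<in>I. g (s i) * c i)" for g :: "'a \<Rightarrow> complex"
  proof -
    have "(\<Sum>v\<in>V. g v * ?x v) = (\<Sum>v\<in>V. \<Sum>i\<in>I. if s i = v then g v * c i else 0)"
      by (simp add: sum_distrib_left if_distrib cong: if_cong)
    also have "\<dots> = (\<Sum>i\<in>I. \<Sum>v\<in>V. if s i = v then g v * c i else 0)" by (rule sum.swap)
    also have "\<dots> = (\<Sum>i\<in>I. g (s i) * c i)"
      using assms by (intro sum.cong refl) (auto simp: sum.delta)
    finally show ?thesis .
  qed
  have clin: "(\<Sum>v\<in>V. cnj (?x v) * g v) = (\<Sum>i\<in>I. cnj (c i) * g (s i))" for g :: "'a \<Rightarrow> complex"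
    using arg_cong[OF lin[of "\<lambda>v. cnj (g v)"], of cnj] by (simp add: mult.commute)
  have "hform V b ?x = (\<Sum>v\<in>V. cnj (?x v) * (\<Sum>w\<in>V. b v w * ?x w))"
    unfolding hform_def by (simp add: sum_distrib_left mult.assoc)
  also have "\<dots> = (\<Sum>v\<in>V. cnj (?x v) * (\<Sum>j\<in>I. b v (s j) * c j))" by (simp only: lin)
  also have "\<dots> = (\<Sum>i\<in>I. cnj (c i) * (\<Sum>j\<in>I. b (s i) (s j) * c j))" by (rule clin)
  finally show ?thesis unfolding hform_def by (simp add: sum_distrib_left mult.assoc)
qed

text \<open>Serves in place of eigenvalue interlacing: a test vector on \<open>I\<close> is pushed
  forward to \<open>V\<close> by fibre sums, so principal submatrices inherit
  semidefiniteness.\<close>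

lemma psd_pullback:
  assumes "psd V b" "finite V" "finite I" "s ` I \<subseteq> V"
  shows "psd I (\<lambda>i j. b (s i) (s j))"
  unfolding psd_def
proof (intro conjI ballI allI)
  show "b (s j) (s i) = cnj (b (s i) (s j))" if "i \<in> I" "j \<in> I" for i j
    using psd_herm[OF assms(1)] assms(4) that by blast
  show "0 \<le> Re (hform I (\<lambda>i j. b (s i) (s j)) x)" for x
    unfolding hform_pullback[OF assms(2-4), of b x, symmetric] by (rule psd_nonneg[OF assms(1)])
qed

section \<open>Null vectors of semidefinite forms\<close>

lemma hform_add:
  assumes "\<And>i j. i \<in> I \<Longrightarrow> j \<in> I \<Longrightarrow> b j i = cnj (b i j)"
  shows "Re (hform I b (\<lambda>i. x i + y i))
    = Re (hform I b x) + 2 * Re (\<Sum>i\<in>I. cnj (y i) * (\<Sum>j\<in>I. b i j * x j)) + Re (hform I b y)"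
proof -
  let ?s = "\<lambda>x y. \<Sum>i\<in>I. \<Sum>j\<in>I. cnj (x i) * b i j * y j"
  have "?s x y = (\<Sum>j\<in>I. \<Sum>i\<in>I. cnj (x i) * b i j * y j)" by (rule sum.swap)
  also have "\<dots> = cnj (?s y x)"
    unfolding cnj_sum
  proof (intro sum.cong refl)
    fix i j assume "i \<in> I" "j \<in> I"
    then show "cnj (x j) * b j i * y i = cnj (cnj (y i) * b i j * x j)"
      using assms[of i j] by simp
  qed
  finally have sw: "Re (?s x y) = Re (?s y x)" by (simp only: cnj.simps)
  have "hform I b (\<lambda>i. x i + y i) = hform I b x + ?s x y + ?s y x + hform I b y"
    unfolding hform_def by (simp add: distrib_left distrib_right sum.distrib add_ac)
  moreover have "(\<Sum>i\<in>I. cnj (y i) * (\<Sum>j\<in>I. b i j * x j)) = ?s y x"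
    by (simp add: sum_distrib_left mult.assoc)
  ultimately show ?thesis using sw by simp
qed

lemma cnj_mult_mult: "cnj z * w * z = of_real ((cmod z)\<^sup>2) * w"
  by (simp only: complex_norm_square mult_ac)

lemma hform_scale: "hform I b (\<lambda>i. t * x i) = of_real ((cmod t)\<^sup>2) * hform I b x"
proof -
  have t: "cnj t * t = of_real ((cmod t)\<^sup>2)" by (metis complex_norm_square mult.commute)
  have "cnj (t * x i) * b i j * (t * x j) = of_real ((cmod t)\<^sup>2) * (cnj (x i) * b i j * x j)" for i j
    unfolding t[symmetric] by (simp add: mult_ac)
  then show ?thesis unfolding hform_def by (simp only: sum_distrib_left)
qed

lemma nonneg_quadratic_imp:
  fixes s q :: real
  assumes "\<And>t. t > 0 \<Longrightarrow> 0 \<le> t * t * q - 2 * t * s"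
  shows "s \<le> 0"
proof (rule ccontr)
  assume s: "\<not> s \<le> 0"
  \<comment> \<open>For \<open>t\<close> this small the quadratic term \<open>t * t * q\<close> is
    at most \<open>t * s\<close> and cannot outweigh \<open>2 * t * s\<close>.\<close>
  define t where "t = s / (\<bar>q\<bar> + 1)"
  have t: "t > 0" using s by (simp add: t_def)
  have "t * (t * q - 2 * s) \<ge> 0" using assms[OF t] by (simp add: algebra_simps)
  then have "t * q \<ge> 2 * s" using t by (simp add: zero_le_mult_iff)
  moreover have "t * q \<le> s"
  proof -
    have "t * q \<le> t * (\<bar>q\<bar> + 1)" using t by (intro mult_left_mono) auto
    also have "\<dots> = s" unfolding t_def by (simp add: field_simps add_nonneg_eq_0_iff)
    finally show ?thesis .
  qed
  ultimately show False using s by simp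
qed

text \<open>A zero of a nonnegative form is a minimum, so its gradient vanishes: moving from
  \<open>x\<close> by \<open>- t\<close> times the image vector \<open>y\<close> changes the form by
  \<open>- 2 * t * s\<close> plus a term of order \<open>t * t\<close>. The kernel relations for
  caps and for paths between them come from this.\<close>

lemma psd_null:
  assumes "psd I b" "finite I" "Re (hform I b x) \<le> 0" "i \<in> I"
  shows "(\<Sum>j\<in>I. b i j * x j) = 0"
proof -
  define y where "y i = (\<Sum>j\<in>I. b i j * x j)" for i
  define s where "s = (\<Sum>i\<in>I. (cmod (y i))\<^sup>2)"
  have "s \<le> 0"
  proof (rule nonneg_quadratic_imp)
    fix t :: real assume "t > 0"
    have "0 \<le> Re (hform I b (\<lambda>i. x i + (- of_real t) * y i))" by (rule psd_nonneg[OF assms(1)])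
    also have "\<dots> = Re (hform I b x) + 2 * Re (\<Sum>i\<in>I. cnj (- of_real t * y i) * y i)
        + Re (hform I b (\<lambda>i. (- of_real t) * y i))"
      unfolding y_def by (rule hform_add) (rule psd_herm[OF assms(1)])
    also have "(\<Sum>i\<in>I. cnj (- of_real t * y i) * y i) = - of_real (t * s)"
    proof -
      have "cnj (- of_real t * y i) * y i = of_real (- t * (cmod (y i))\<^sup>2)" for i
        by (simp add: complex_norm_square del: of_real_power)
      then show ?thesis unfolding s_def by (simp only: of_real_sum[symmetric] of_real_minus[symmetric] sum_distrib_left sum_negf[symmetric] mult_minus_left)
    qed
    also have "hform I b (\<lambda>i. (- of_real t) * y i) = of_real (t * t) * hform I b y"
      by (subst hform_scale) (simp add: power2_eq_square)
    finally show "0 \<le> t * t * Re (hform I b y) - 2 * t * s"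
      using assms(3) by simp
  qed
  then have "(\<Sum>i\<in>I. (cmod (y i))\<^sup>2) = 0" unfolding s_def by (simp add: antisym sum_nonneg)
  then have "y i = 0" using assms(2,4) by (simp add: sum_nonneg_eq_0_iff)
  then show ?thesis by (simp add: y_def)
qed

section \<open>Forms along a path\<close>

lemma hform_extend_path:
  fixes p k :: nat
  assumes herm: "\<And>i j. i < p + k \<Longrightarrow> j < p + k \<Longrightarrow> b j i = cnj (b i j)"
    and path: "\<And>i j. p \<le> j \<Longrightarrow> j < p + k \<Longrightarrow> i + 1 < j \<Longrightarrow> b i j = 0" and "p > 0"
  shows "Re (hform {..<p + k} b c) = Re (hform {..<p} b c)
     + (\<Sum>i<k. (cmod (c (p + i)))\<^sup>2 * Re (b (p + i) (p + i))
            + 2 * Re (cnj (c (p + i - 1)) * b (p + i - 1) (p + i) * c (p + i)))"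
  using assms(1,2)
proof (induction k)
  case 0
  show ?case by simp
next
  case (Suc k)
  let ?n = "p + k"
  \<comment> \<open>The last index meets only its predecessor, so one term survives. The indices
    below \<open>p\<close> form an arbitrary core; \<open>p > 0\<close> supplies a predecessor for
    the first path vertex.\<close>
  have row: "(\<Sum>i<?n. cnj (c i) * b i ?n * c ?n) = cnj (c (?n - 1)) * b (?n - 1) ?n * c ?n"
  proof -
    have "(\<Sum>i<?n. cnj (c i) * b i ?n * c ?n)
        = (\<Sum>i\<in>{?n - 1}. cnj (c i) * b i ?n * c ?n)"
      using \<open>p > 0\<close> Suc.prems(2)[of ?n] by (intro sum.mono_neutral_right) auto
    then show ?thesis by simp
  qed
  have col: "(\<Sum>j<?n. cnj (c ?n) * b ?n j * c j) = cnj (\<Sum>i<?n. cnj (c i) * b i ?n * c ?n)"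
    unfolding cnj_sum
  proof (intro sum.cong refl)
    fix i assume "i \<in> {..<?n}"
    then show "cnj (c ?n) * b ?n i * c i = cnj (cnj (c i) * b i ?n * c ?n)"
      using Suc.prems(1)[of i ?n] by simp
  qed
  have "hform {..<p + Suc k} b c = hform {..<?n} b c + (\<Sum>i<?n. cnj (c i) * b i ?n * c ?n)
      + (\<Sum>j<?n. cnj (c ?n) * b ?n j * c j) + cnj (c ?n) * b ?n ?n * c ?n"
    unfolding hform_def by (simp add: sum.distrib)
  moreover have "Re (cnj (c ?n) * b ?n ?n * c ?n) = (cmod (c ?n))\<^sup>2 * Re (b ?n ?n)"
    unfolding cnj_mult_mult by simp
  moreover have "Re (hform {..<?n} b c) = Re (hform {..<p} b c)
     + (\<Sum>i<k. (cmod (c (p + i)))\<^sup>2 * Re (b (p + i) (p + i))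
            + 2 * Re (cnj (c (p + i - 1)) * b (p + i - 1) (p + i) * c (p + i)))"
    by (rule Suc.IH; rule Suc.prems; simp)
  ultimately show ?case
    unfolding col row by (simp only: plus_complex.sel cnj.simps sum.lessThan_Suc)
qed

lemma hform_path:
  assumes "\<And>i j. i \<le> k \<Longrightarrow> j \<le> k \<Longrightarrow> b j i = cnj (b i j)"
    and "\<And>i j. j \<le> k \<Longrightarrow> i + 1 < j \<Longrightarrow> b i j = 0"
  shows "Re (hform {..k} b c) = (\<Sum>i\<le>k. (cmod (c i))\<^sup>2 * Re (b i i))
     + 2 * (\<Sum>i<k. Re (cnj (c i) * b i (Suc i) * c (Suc i)))"
proof -
  have "Re (hform {..<1 + k} b c) = Re (hform {..<1} b c)
     + (\<Sum>i<k. (cmod (c (1 + i)))\<^sup>2 * Re (b (1 + i) (1 + i))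
            + 2 * Re (cnj (c (1 + i - 1)) * b (1 + i - 1) (1 + i) * c (1 + i)))"
  proof (rule hform_extend_path)
    show "b j i = cnj (b i j)" if "i < 1 + k" "j < 1 + k" for i j
      by (rule assms(1)) (use that in auto)
    show "b i j = 0" if "1 \<le> j" "j < 1 + k" "i + 1 < j" for i j
      by (rule assms(2)) (use that in auto)
  qed simp
  moreover have "Re (hform {..<1} b c) = (cmod (c 0))\<^sup>2 * Re (b 0 0)"
    by (simp add: hform_def cnj_mult_mult del: of_real_power)
  moreover have "{..<1 + k} = {..k}" by auto
  moreover have "(\<Sum>i\<le>k. (cmod (c i))\<^sup>2 * Re (b i i))
      = (cmod (c 0))\<^sup>2 * Re (b 0 0) + (\<Sum>i<k. (cmod (c (Suc i)))\<^sup>2 * Re (b (Suc i) (Suc i)))"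
    by (rule sum.atMost_shift)
  ultimately show ?thesis by (simp only: sum.distrib sum_distrib_left plus_1_eq_Suc diff_Suc_1 add_ac)
qed

text \<open>A path has no cycle, so its vertices can be switched one after another by unit scalars
  until every edge is real and nonnegative. At a zero edge the phase is carried on
  unchanged.\<close>

lemma path_phases:
  fixes w :: "nat \<Rightarrow> complex"
  obtains \<phi> :: "nat \<Rightarrow> complex" where "\<phi> 0 = 1" "\<And>i. cmod (\<phi> i) = 1"
    "\<And>i. cnj (\<phi> i) * w i * \<phi> (Suc i) = of_real (cmod (w i))"
proof -
  define \<phi> where "\<phi> = rec_nat 1 (\<lambda>i z. z * (if w i = 0 then 1 else cnj (sgn (w i))))"
  have 1: "\<phi> 0 = 1" by (simp add: \<phi>_def)
  have s: "\<phi> (Suc i) = \<phi> i * (if w i = 0 then 1 else cnj (sgn (w i)))" for i by (simp add: \<phi>_def)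
  have 2: "cmod (\<phi> i) = 1" for i
    by (induction i) (auto simp: 1 s norm_mult norm_sgn)
  have 3: "cnj (\<phi> i) * w i * \<phi> (Suc i) = of_real (cmod (w i))" for i
  proof -
    let ?z = "if w i = 0 then 1 else cnj (sgn (w i))"
    have "cnj (\<phi> i) * w i * \<phi> (Suc i) = (\<phi> i * cnj (\<phi> i)) * (w i * ?z)"
      unfolding s by (simp only: mult_ac)
    also have "\<phi> i * cnj (\<phi> i) = 1" by (simp only: complex_norm_square[symmetric] 2) simp
    also have "1 * (w i * ?z) = of_real (cmod (w i))"
    proof (cases "w i = 0")
      case False
      have "w i * cnj (sgn (w i)) = (w i * cnj (w i)) / of_real (cmod (w i))"
        by (simp add: sgn_eq)
      also have "\<dots> = of_real (cmod (w i))"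
        using False by (simp add: complex_norm_square[symmetric] power2_eq_square del: of_real_power)
      finally show ?thesis using False by simp
    qed simp
    finally show ?thesis .
  qed
  show ?thesis using that 1 2 3 by blast
qed

section \<open>Cyclotomic kernels\<close>

text \<open>The matrix \<open>2 + e A\<close>. For Hermitian \<open>A\<close>, semidefiniteness at
  both \<open>e = 1\<close> and \<open>e = -1\<close> means that the spectrum lies in
  [-2, 2].\<close>

definition shifted :: "real \<Rightarrow> ('v \<Rightarrow> 'v \<Rightarrow> complex) \<Rightarrow> 'v \<Rightarrow> 'v \<Rightarrow> complex" where
  "shifted e a i j = (if i = j then 2 else 0) + of_real e * a i j"

definition edges :: "'v set \<Rightarrow> ('v \<Rightarrow> 'v \<Rightarrow> complex) \<Rightarrow> ('v \<times> 'v) set" where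
  "edges V a = {(i, j). i \<in> V \<and> j \<in> V \<and> a i j \<noteq> 0}"

text \<open>Functions on a finite index set instead of matrices: deleting, reordering and cutting
  out a path are then all instances of \<open>pullback\<close>. Of the ring only the possible moduli
  of edges are retained.\<close>

locale cyclotomic_kernel =
  fixes V :: "'v set" and a :: "'v \<Rightarrow> 'v \<Rightarrow> complex"
  assumes finite_V: "finite V"
    and psd_shifted: "e \<in> {1, -1} \<Longrightarrow> psd V (shifted e a)"
    and charge: "i \<in> V \<Longrightarrow> a i i \<in> {0, 1, -1}"
    and weight: "i \<in> V \<Longrightarrow> j \<in> V \<Longrightarrow> i \<noteq> j \<Longrightarrow> a i j = 0 \<or> (cmod (a i j))\<^sup>2 \<in> {1, 2, 3, 4}"
begin

abbreviation E :: "('v \<times> 'v) set" where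
  "E \<equiv> edges V a"

lemma herm: "i \<in> V \<Longrightarrow> j \<in> V \<Longrightarrow> a j i = cnj (a i j)"
  using psd_herm[OF psd_shifted[of 1], of i j] by (auto simp: shifted_def split: if_splits)

lemma E_sym: "(i, j) \<in> E \<Longrightarrow> (j, i) \<in> E"
  using herm[of i j] by (auto simp: edges_def)

lemma norm_ge_1: "i \<in> V \<Longrightarrow> j \<in> V \<Longrightarrow> a i j \<noteq> 0 \<Longrightarrow> 1 \<le> cmod (a i j)"
proof (cases "i = j")
  case False
  assume "i \<in> V" "j \<in> V" "a i j \<noteq> 0"
  then have "1 \<le> (cmod (a i j))\<^sup>2" using weight[of i j] False by auto
  then show ?thesis by (metis norm_ge_zero one_power2 power2_le_imp_le)
qed (use charge[of i] in auto)

lemma pullback: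
  assumes "finite I" "inj_on s I" "s ` I \<subseteq> V"
  shows "cyclotomic_kernel I (\<lambda>i j. a (s i) (s j))"
proof
  show "psd I (shifted e (\<lambda>i j. a (s i) (s j)))" if "e \<in> {1, -1}" for e
  proof -
    have "psd I (\<lambda>i j. shifted e a (s i) (s j))"
      by (rule psd_pullback[OF psd_shifted[OF that] finite_V assms(1,3)])
    then show ?thesis
      by (subst psd_cong[where b' = "\<lambda>i j. shifted e a (s i) (s j)"])
        (use assms(2) in \<open>auto simp: shifted_def inj_on_def\<close>)
  qed
  show "a (s i) (s i) \<in> {0, 1, -1}" if "i \<in> I" for i
    using that assms(3) by (intro charge) auto
  show "a (s i) (s j) = 0 \<or> (cmod (a (s i) (s j)))\<^sup>2 \<in> {1, 2, 3, 4}"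
    if "i \<in> I" "j \<in> I" "i \<noteq> j" for i j
    using that assms by (intro weight) (auto simp: inj_on_def)
qed (rule assms)

text \<open>The bound is the diagonal entry of \<open>4 - A * A \<ge> 0\<close>. With
  \<open>y\<close> the column at \<open>i\<close> and the test vector that is \<open>2\<close> at
  \<open>i\<close> minus \<open>e * y\<close>, adding the two forms cancels the terms odd in
  \<open>e\<close>, that is, the charge and the cubic term, and leaves
  \<open>16 - 8 * s + 4 * s\<close>.\<close>

lemma row_weight:
  assumes i: "i \<in> V"
  shows "(\<Sum>j\<in>V. (cmod (a j i))\<^sup>2) \<le> 4"
proof -
  define y where "y j = a j i" for j
  define s where "s = (\<Sum>j\<in>V. (cmod (y j))\<^sup>2)"
  define h where "h e = Re (hform V (shifted e a) y)" for e
  let ?x = "\<lambda>j. if j = i then 2 else 0 :: complex"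
  have main: "0 \<le> 4 * (2 + e * Re (a i i)) + 2 * (- 4 * e * Re (a i i) - 2 * s) + h e"
    if e: "e \<in> {1, -1}" for e :: real
  proof -
    have "0 \<le> Re (hform V (shifted e a) (\<lambda>j. ?x j + (- of_real e) * y j))"
      by (rule psd_nonneg[OF psd_shifted[OF e]])
    also have "\<dots> = Re (hform V (shifted e a) ?x)
        + 2 * Re (\<Sum>j\<in>V. cnj ((- of_real e) * y j) * (\<Sum>k\<in>V. shifted e a j k * ?x k))
        + Re (hform V (shifted e a) (\<lambda>j. (- of_real e) * y j))"
      by (rule hform_add) (rule psd_herm[OF psd_shifted[OF e]])
    also have "hform V (shifted e a) (\<lambda>j. (- of_real e) * y j) = hform V (shifted e a) y"
      using e by (subst hform_scale) auto
    also have "hform V (shifted e a) ?x = 4 * shifted e a i i"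
    proof -
      have "hform V (shifted e a) ?x
          = (\<Sum>j\<in>V. if j = i then 2 * (\<Sum>k\<in>V. if k = i then shifted e a j k * 2 else 0) else 0)"
        unfolding hform_def by (intro sum.cong refl) (simp add: sum_distrib_left if_distrib cong: if_cong)
      then show ?thesis using i finite_V by (simp add: sum.delta)
    qed
    also have "(\<Sum>j\<in>V. cnj ((- of_real e) * y j) * (\<Sum>k\<in>V. shifted e a j k * ?x k))
        = (\<Sum>j\<in>V. cnj ((- of_real e) * y j) * (shifted e a j i * 2))"
    proof (intro sum.cong refl arg_cong2[where f = "(*)"])
      fix j
      have "(\<Sum>k\<in>V. shifted e a j k * ?x k) = (\<Sum>k\<in>V. if k = i then shifted e a j k * 2 else 0)"
        by (intro sum.cong) auto
      then show "(\<Sum>k\<in>V. shifted e a j k * ?x k) = shifted e a j i * 2"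
        using i finite_V by (simp add: sum.delta)
    qed
    also have "\<dots> = (\<Sum>j\<in>V. (if j = i then - 4 * of_real e * cnj (a j i) else 0)
          + of_real (- 2 * (cmod (y j))\<^sup>2))"
    proof (intro sum.cong refl)
      fix j
      have ee: "complex_of_real e * of_real e = 1" using e by auto
      have "cnj ((- of_real e) * y j) * (shifted e a j i * 2)
          = (if j = i then - 4 * of_real e * cnj (a j i) else 0)
          - 2 * (of_real e * of_real e) * (y j * cnj (y j))"
        by (simp add: y_def shifted_def algebra_simps)
      then show "cnj ((- of_real e) * y j) * (shifted e a j i * 2)
          = (if j = i then - 4 * of_real e * cnj (a j i) else 0) + of_real (- 2 * (cmod (y j))\<^sup>2)"
        unfolding ee by (simp add: complex_norm_square del: of_real_power)
    qed
    also have "\<dots> = - 4 * of_real e * cnj (a i i) + of_real (- 2 * s)"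
      using i finite_V by (simp add: sum_subtractf s_def sum_distrib_left sum_negf)
    finally show ?thesis by (simp add: h_def shifted_def[of e a i i])
  qed
  have "hform V (shifted 1 a) y + hform V (shifted (-1) a) y
      = (\<Sum>j\<in>V. \<Sum>k\<in>V. if j = k then 4 * (cnj (y j) * y j) else 0)"
    unfolding hform_def sum.distrib[symmetric]
    by (intro sum.cong refl) (simp add: shifted_def algebra_simps)
  also have "\<dots> = (\<Sum>j\<in>V. of_real (4 * (cmod (y j))\<^sup>2))"
    using finite_V by (intro sum.cong refl)
      (simp add: sum.delta' complex_norm_square mult.commute del: of_real_power)
  also have "\<dots> = of_real (4 * s)" by (simp add: s_def sum_distrib_left)
  finally have "h 1 + h (-1) = 4 * s"
    unfolding h_def by (simp only: plus_complex.sel[symmetric] Re_complex_of_real)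
  then have "s \<le> 4" using main[of 1] main[of "-1"] by simp
  then show ?thesis by (simp add: s_def y_def)
qed

lemma degree_le_4:
  assumes i: "i \<in> V"
  shows "card {j \<in> V. (i, j) \<in> E} \<le> 4"
proof -
  have "real (card {j \<in> V. (i, j) \<in> E}) = (\<Sum>j\<in>{j \<in> V. (i, j) \<in> E}. 1)" by simp
  also have "\<dots> \<le> (\<Sum>j\<in>{j \<in> V. (i, j) \<in> E}. (cmod (a j i))\<^sup>2)"
  proof (rule sum_mono)
    fix j assume "j \<in> {j \<in> V. (i, j) \<in> E}"
    then have "1 \<le> cmod (a j i)" using norm_ge_1[of j i] E_sym[of i j] by (auto simp: edges_def)
    then show "1 \<le> (cmod (a j i))\<^sup>2" by simp
  qed
  also have "\<dots> \<le> (\<Sum>j\<in>V. (cmod (a j i))\<^sup>2)"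
    using finite_V by (intro sum_mono2) auto
  also have "\<dots> \<le> 4" by (rule row_weight[OF i])
  finally show ?thesis by simp
qed

end

text \<open>A path is bipartite: the sign \<open>(- e) ^ i\<close> gives the edge terms the same
  value for both choices of \<open>e\<close>, so the two forms differ only on the diagonal.\<close>

lemma hform_path_phased:
  fixes e :: real and g :: "nat \<Rightarrow> real"
  assumes herm: "\<And>i j. i \<le> k \<Longrightarrow> j \<le> k \<Longrightarrow> b j i = cnj (b i j)"
    and path: "\<And>i j. j \<le> k \<Longrightarrow> i + 1 < j \<Longrightarrow> b i j = 0"
    and e: "e \<in> {1, -1}" and edge: "\<And>i. i < k \<Longrightarrow> b i (Suc i) = of_real e * w i"
    and \<phi>: "\<And>i. cmod (\<phi> i) = 1" "\<And>i. cnj (\<phi> i) * w i * \<phi> (Suc i) = of_real (cmod (w i))"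
  shows "Re (hform {..k} b (\<lambda>i. of_real ((- e) ^ i * g i) * \<phi> i))
     = (\<Sum>i\<le>k. (g i)\<^sup>2 * Re (b i i)) - 2 * (\<Sum>i<k. cmod (w i) * g i * g (Suc i))"
proof -
  have ee: "e * e = 1" using e by auto
  have pow: "(- e) ^ i * (- e) ^ i = 1" for i
    using ee by (simp add: power_mult_distrib[symmetric])
  have "cmod (of_real ((- e) ^ i * g i) * \<phi> i) ^ 2 = (g i)\<^sup>2" for i
    using e by (auto simp: norm_mult \<phi>(1) norm_power power_mult_distrib abs_mult power_abs)
  moreover have "Re (cnj (of_real ((- e) ^ i * g i) * \<phi> i) * b i (Suc i)
        * (of_real ((- e) ^ Suc i * g (Suc i)) * \<phi> (Suc i))) = - (cmod (w i) * g i * g (Suc i))"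
    if "i < k" for i
  proof -
    have "cnj (of_real ((- e) ^ i * g i) * \<phi> i) * b i (Suc i)
        * (of_real ((- e) ^ Suc i * g (Suc i)) * \<phi> (Suc i))
        = of_real (- (e * e) * ((- e) ^ i * (- e) ^ i) * g i * g (Suc i))
          * (cnj (\<phi> i) * w i * \<phi> (Suc i))"
      unfolding edge[OF that] by (simp add: mult_ac)
    also have "\<dots> = of_real (- (cmod (w i) * g i * g (Suc i)))"
      unfolding \<phi>(2) pow ee by simp
    finally show ?thesis by (simp only: Re_complex_of_real)
  qed
  ultimately show ?thesis
    using hform_path[OF herm path, where c = "\<lambda>i. of_real ((- e) ^ i * g i) * \<phi> i"]
    by (simp add: sum_negf)
qed

text \<open>Between the two forms only the charges change sign, so the two inequalities merge into
  one with an absolute value.\<close>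

lemma path_inequality:
  assumes "cyclotomic_kernel {..k} a" and path: "\<And>i j. j \<le> k \<Longrightarrow> i + 1 < j \<Longrightarrow> a i j = 0"
  shows "\<bar>\<Sum>i\<le>k. Re (a i i) * (g i)\<^sup>2\<bar>
     \<le> 2 * (\<Sum>i\<le>k. (g i)\<^sup>2) - 2 * (\<Sum>i<k. cmod (a i (Suc i)) * g i * g (Suc i))"
proof -
  interpret cyclotomic_kernel "{..k}" a by fact
  obtain \<phi> :: "nat \<Rightarrow> complex" where \<phi>: "\<And>i. cmod (\<phi> i) = 1"
    "\<And>i. cnj (\<phi> i) * a i (Suc i) * \<phi> (Suc i) = of_real (cmod (a i (Suc i)))"
    by (rule path_phases[of "\<lambda>i. a i (Suc i)"]) (rule that)
  have "0 \<le> (\<Sum>i\<le>k. (g i)\<^sup>2 * Re (shifted e a i i)) - 2 * (\<Sum>i<k. cmod (a i (Suc i)) * g i * g (Suc i))"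
    if e: "e \<in> {1, -1}" for e :: real
  proof -
    have "Re (hform {..k} (shifted e a) (\<lambda>i. of_real ((- e) ^ i * g i) * \<phi> i))
      = (\<Sum>i\<le>k. (g i)\<^sup>2 * Re (shifted e a i i)) - 2 * (\<Sum>i<k. cmod (a i (Suc i)) * g i * g (Suc i))"
    proof (rule hform_path_phased[where w = "\<lambda>i. a i (Suc i)", OF _ _ e _ \<phi>])
      show "shifted e a j i = cnj (shifted e a i j)" if "i \<le> k" "j \<le> k" for i j
        by (rule psd_herm[OF psd_shifted[OF e]]) (use that in auto)
    qed (auto simp: shifted_def path)
    then show ?thesis using psd_nonneg[OF psd_shifted[OF e], of "\<lambda>i. of_real ((- e) ^ i * g i) * \<phi> i"] by simp
  qed
  from this[of 1] this[of "-1"] show ?thesis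
    by (simp add: shifted_def algebra_simps sum.distrib sum_subtractf sum_distrib_left[symmetric] abs_le_iff)
qed

text \<open>
  The test vectors are tents of height 1 and slope 1/10 centred at the vertex 10. Raising the
  value at the centre to 2 isolates the charge there.
\<close>

lemma path_centre:
  assumes "cyclotomic_kernel {..20} a"
    and path: "\<And>i j. j \<le> 20 \<Longrightarrow> i + 1 < j \<Longrightarrow> a i j = 0"
    and edge: "\<And>i. i < 20 \<Longrightarrow> a i (Suc i) \<noteq> 0"
  shows "cmod (a 10 11) = 1" and "a 10 10 = 0"
proof -
  interpret cyclotomic_kernel "{..20::nat}" a by fact
  define g :: "nat \<Rightarrow> real" where "g i = (if i \<le> 10 then real i / 10 else (20 - real i) / 10)" for i
  define w where "w i = cmod (a i (Suc i))" for i
  define d where "d i = Re (a i i)" for i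
  have w1: "1 \<le> w i" if "i < 20" for i
    unfolding w_def using norm_ge_1[of i "Suc i"] edge[of i] that by auto
  have bound: "\<bar>\<Sum>i\<le>20. d i * (f i)\<^sup>2\<bar>
      \<le> 2 * (\<Sum>i\<le>20. (f i)\<^sup>2) - 2 * (\<Sum>i<20. f i * f (Suc i)) - 2 * (w 10 - 1) * f 10 * f 11"
    if f: "\<And>i. i \<le> 20 \<Longrightarrow> 0 \<le> f i" for f :: "nat \<Rightarrow> real"
  proof -
    have "(\<Sum>i<20. f i * f (Suc i)) + (w 10 - 1) * f 10 * f 11
        = (\<Sum>i<20. f i * f (Suc i) + (if i = 10 then (w 10 - 1) * f 10 * f 11 else 0))"
      by (simp add: sum.distrib)
    also have "\<dots> \<le> (\<Sum>i<20. w i * f i * f (Suc i))"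
    proof (rule sum_mono)
      fix i :: nat assume i: "i \<in> {..<20}"
      have "1 * (f i * f (Suc i)) \<le> w i * (f i * f (Suc i))"
        using i w1[of i] f by (intro mult_right_mono) auto
      then show "f i * f (Suc i) + (if i = 10 then (w 10 - 1) * f 10 * f 11 else 0)
          \<le> w i * f i * f (Suc i)"
        by (auto simp: algebra_simps)
    qed
    finally show ?thesis
      using path_inequality[OF assms(1) path, of f] by (simp add: w_def d_def algebra_simps)
  qed
  have g0: "0 \<le> g i" if "i \<le> 20" for i using that by (auto simp: g_def)
  have tent: "\<bar>\<Sum>i\<le>20. d i * (g i)\<^sup>2\<bar> \<le> 1 / 5 - 2 * (w 10 - 1) * (9 / 10)"
  proof -
    \<comment> \<open>Since the tent vanishes at both ends, this is the sum of its squared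
      increments, twenty times 1/100.\<close>
    have "2 * (\<Sum>i\<le>20. (g i)\<^sup>2) - 2 * (\<Sum>i<20. g i * g (Suc i)) = 1 / 5"
      by (simp add: g_def eval_nat_numeral)
    moreover have g: "g 10 = 1" "g 11 = 9 / 10" by (simp_all add: g_def)
    ultimately show ?thesis using bound[of g, OF g0] unfolding g by linarith
  qed
  \<comment> \<open>The next admissible weight has square 2, which exceeds 100/81.\<close>
  have "w 10 \<le> 10 / 9" using order_trans[OF abs_ge_zero tent] by (simp add: field_simps)
  then have "(w 10)\<^sup>2 \<le> (10 / 9)\<^sup>2" using w1[of 10] by (intro power_mono) auto
  then have "(w 10)\<^sup>2 < 2" by (simp add: power2_eq_square)
  moreover have "(w 10)\<^sup>2 \<in> {1, 2, 3, 4}"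
    using weight[of 10 11] edge[of 10] by (auto simp: w_def)
  ultimately have "(w 10)\<^sup>2 = 1" by auto
  then show "cmod (a 10 11) = 1" using w1[of 10] by (simp add: w_def power2_eq_1_iff)
  define g' where "g' = g(10 := 2)"
  have g'0: "0 \<le> g' i" if "i \<le> 20" for i using g0 that by (auto simp: g'_def)
  have "(\<Sum>i\<le>20. d i * (g' i)\<^sup>2) = (\<Sum>i\<le>20. d i * (g i)\<^sup>2 + (if i = 10 then 3 * d 10 else 0))"
    by (intro sum.cong refl) (auto simp: g'_def g_def)
  also have "\<dots> = (\<Sum>i\<le>20. d i * (g i)\<^sup>2) + 3 * d 10" by (simp add: sum.distrib)
  finally have "\<bar>(\<Sum>i\<le>20. d i * (g i)\<^sup>2) + 3 * d 10\<bar> \<le> 13 / 5 - 2 * (w 10 - 1) * (9 / 5)"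
  proof -
    assume eq: "(\<Sum>i\<le>20. d i * (g' i)\<^sup>2) = (\<Sum>i\<le>20. d i * (g i)\<^sup>2) + 3 * d 10"
    \<comment> \<open>The two increments at the centre are now 11/10, so the energy is 18/100 + 2 *
      121/100.\<close>
    have "2 * (\<Sum>i\<le>20. (g' i)\<^sup>2) - 2 * (\<Sum>i<20. g' i * g' (Suc i)) = 13 / 5"
      by (simp add: g'_def g_def eval_nat_numeral)
    moreover have g': "g' 10 = 2" "g' 11 = 9 / 10" by (simp_all add: g_def g'_def)
    ultimately show ?thesis using bound[of g', OF g'0] unfolding eq g' by linarith
  qed
  then have "\<bar>(\<Sum>i\<le>20. d i * (g i)\<^sup>2) + 3 * d 10\<bar> \<le> 13 / 5"
    by (rule order_trans) (use w1[of 10] in simp)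
  moreover have "\<bar>\<Sum>i\<le>20. d i * (g i)\<^sup>2\<bar> \<le> 1 / 5"
    using tent by (rule order_trans) (use w1[of 10] in simp)
  \<comment> \<open>Raising the height from 1 to 2 adds the central charge \<open>4 - 1 = 3\<close>
    times, and 13/5 + 1/5 is less than 3, so a charge in \<open>{0, 1, -1}\<close> must
    vanish.\<close>
  moreover have "\<bar>y\<bar> < 1" if "\<bar>x + 3 * y\<bar> \<le> 13 / 5" "\<bar>x\<bar> \<le> 1 / 5" for x y :: real
    using that by linarith
  ultimately have "\<bar>d 10\<bar> < 1" by blast
  then show "a 10 10 = 0" using charge[of 10] by (auto simp: d_def)
qed

section \<open>Distance levels and shortest paths\<close>

context cyclotomic_kernel
begin

definition level :: "'v set \<Rightarrow> 'v \<Rightarrow> nat" where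
  "level X v = (LEAST k. \<exists>x\<in>X. (x, v) \<in> E ^^ k)"

text \<open>A shortest path issuing from \<open>X\<close>. In a connected kernel levels change by at
  most one along an edge, so prescribing level \<open>i\<close> at position \<open>i\<close> also
  rules out chords.\<close>

definition level_path :: "'v set \<Rightarrow> (nat \<Rightarrow> 'v) \<Rightarrow> nat \<Rightarrow> bool" where
  "level_path X s m \<longleftrightarrow> s 0 \<in> X \<and> (\<forall>i<m. (s i, s (Suc i)) \<in> E) \<and> (\<forall>i\<le>m. s i \<in> V \<and> level X (s i) = i)"

lemma level_le: "x \<in> X \<Longrightarrow> (x, v) \<in> E ^^ k \<Longrightarrow> level X v \<le> k"
  unfolding level_def by (rule Least_le) blast

end

locale connected_kernel = cyclotomic_kernel +
  assumes connected: "i \<in> V \<Longrightarrow> j \<in> V \<Longrightarrow> (i, j) \<in> E\<^sup>*"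
begin

context
  fixes X
  assumes X: "X \<subseteq> V" "X \<noteq> {}"
begin

lemma level_attained:
  assumes "v \<in> V"
  obtains x where "x \<in> X" "(x, v) \<in> E ^^ level X v"
proof -
  obtain x where x: "x \<in> X" using X by blast
  then have "(x, v) \<in> E\<^sup>*" using connected assms X by blast
  then have "\<exists>k. \<exists>x\<in>X. (x, v) \<in> E ^^ k" using x rtrancl_imp_relpow by blast
  then have "\<exists>x\<in>X. (x, v) \<in> E ^^ level X v"
    unfolding level_def by (rule LeastI_ex)
  then show ?thesis using that by blast
qed

lemma level_edge_le: "(v, w) \<in> E \<Longrightarrow> level X w \<le> Suc (level X v)"
proof -
  assume vw: "(v, w) \<in> E"
  then have "v \<in> V" by (auto simp: edges_def)
  then obtain x where "x \<in> X" "(x, v) \<in> E ^^ level X v" by (rule level_attained)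
  then show ?thesis using vw by (intro level_le[of x]) auto
qed

lemma level_edge: "(v, w) \<in> E \<Longrightarrow> level X w \<le> Suc (level X v) \<and> level X v \<le> Suc (level X w)"
  using level_edge_le E_sym by blast

lemma level_zero_iff: "v \<in> V \<Longrightarrow> level X v = 0 \<longleftrightarrow> v \<in> X"
proof
  assume "v \<in> V" "level X v = 0"
  then show "v \<in> X" using level_attained[of v] by auto
next
  assume "v \<in> X"
  then have "level X v \<le> 0" by (rule level_le) simp
  then show "level X v = 0" by simp
qed

text \<open>Along a shortest walk the level is at most \<open>i\<close> counting from the start and
  at least \<open>i\<close> counting back from the end.\<close>

lemma level_path_exists:
  assumes "v \<in> V"
  obtains s where "level_path X s (level X v)" "s (level X v) = v"
proof -
  let ?m = "level X v"
  obtain x where x: "x \<in> X" "(x, v) \<in> E ^^ ?m" using level_attained[OF assms] by blast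
  then obtain s where s: "s 0 = x" "s ?m = v" "\<forall>i<?m. (s i, s (Suc i)) \<in> E"
    by (auto simp: relpow_fun_conv)
  have up: "level X (s i) \<le> i" if "i \<le> ?m" for i
    using that
  proof (induction i)
    case 0
    have "x \<in> V" using x X by blast
    then show ?case using x s level_zero_iff[of x] by simp
  next
    case (Suc i)
    then have "(s i, s (Suc i)) \<in> E" "level X (s i) \<le> i" using s by auto
    then show ?case using level_edge_le[of "s i" "s (Suc i)"] by simp
  qed
  have down: "?m \<le> level X (s i) + (?m - i)" if "i \<le> ?m" for i
    using that
  proof (induction rule: inc_induct)
    case base
    then show ?case using s by simp
  next
    case (step n)
    then have "(s n, s (Suc n)) \<in> E" using s by auto
    then show ?case using level_edge_le[of "s n" "s (Suc n)"] step by simp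
  qed
  have "s i \<in> V" if "i \<le> ?m" for i
    using that s x X by (cases i) (auto simp: edges_def)
  moreover have "level X (s i) = i" if "i \<le> ?m" for i
    using up[OF that] down[OF that] that by simp
  ultimately have "level_path X s ?m" unfolding level_path_def using s x by simp
  then show ?thesis using that s by blast
qed

text \<open>The factor 5 counts a vertex together with its at most four neighbours.\<close>

lemma card_level_le: "card {v \<in> V. level X v \<le> k} \<le> card X * 5 ^ k"
proof (induction k)
  case 0
  have "{v \<in> V. level X v \<le> 0} = X" using level_zero_iff X by auto
  then show ?case by simp
next
  case (Suc k)
  let ?B = "{v \<in> V. level X v \<le> k}"
  let ?N = "\<lambda>v. insert v {w \<in> V. (v, w) \<in> E}"
  have fin: "finite ?B" using finite_V by simp
  have "{v \<in> V. level X v \<le> Suc k} \<subseteq> (\<Union>v\<in>?B. ?N v)"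
  proof
    fix w assume w: "w \<in> {v \<in> V. level X v \<le> Suc k}"
    then have wV: "w \<in> V" by simp
    show "w \<in> (\<Union>v\<in>?B. ?N v)"
    proof (cases "level X w \<le> k")
      case False
      then have l: "level X w = Suc k" using w by simp
      obtain s where "level_path X s (level X w)" "s (level X w) = w"
        using level_path_exists[OF wV] by blast
      then have "s k \<in> ?B" "(s k, w) \<in> E" unfolding l level_path_def by auto
      then show ?thesis using wV by blast
    qed (use wV in auto)
  qed
  then have "card {v \<in> V. level X v \<le> Suc k} \<le> card (\<Union>v\<in>?B. ?N v)"
    using finite_V fin by (intro card_mono) auto
  also have "\<dots> \<le> (\<Sum>v\<in>?B. card (?N v))" using fin by (rule card_UN_le)
  also have "\<dots> \<le> (\<Sum>v\<in>?B. 5)"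
  proof (rule sum_mono)
    fix v assume "v \<in> ?B"
    then show "card (?N v) \<le> 5"
      using degree_le_4[of v] card_insert_le_m1[of 5 "{w \<in> V. (v, w) \<in> E}" v] by simp
  qed
  also have "\<dots> = 5 * card ?B" by simp
  finally show ?case using Suc.IH by simp
qed

lemma exists_high_level:
  assumes "card X * 5 ^ k < card V"
  obtains v where "v \<in> V" "k < level X v"
proof -
  have "\<not> V \<subseteq> {v \<in> V. level X v \<le> k}"
  proof
    assume "V \<subseteq> {v \<in> V. level X v \<le> k}"
    then have "card V \<le> card {v \<in> V. level X v \<le> k}" using finite_V by (intro card_mono) auto
    then show False using card_level_le[of k] assms by simp
  qed
  then obtain v where "v \<in> V" "\<not> level X v \<le> k" by blast
  then show ?thesis using that[of v] by simp
qed

end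

lemma level_path_inj:
  assumes "level_path X s m" "i \<le> m" "j \<le> m" "s i = s j"
  shows "i = j"
  using assms unfolding level_path_def by metis

end

section \<open>Two caps bound the graph\<close>

lemma sum_over_pair:
  fixes g :: "'v \<Rightarrow> 'b::comm_monoid_add"
  assumes "finite V" "u \<in> V" "v \<in> V" "u \<noteq> v"
  shows "(\<Sum>i\<in>V. if i \<in> {u, v} then g i else 0) = g u + g v"
proof -
  have "(\<Sum>i\<in>V. if i \<in> {u, v} then g i else 0) = (\<Sum>i\<in>{u, v}. if i \<in> {u, v} then g i else 0)"
    using assms by (intro sum.mono_neutral_right) auto
  then show ?thesis using assms by simp
qed

text \<open>Deflation: \<open>u + v\<close> is an eigenvector of \<open>b\<close> for
  \<open>3 + 1 = 4\<close> of squared length 2, so removing its spectral component subtracts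
  \<open>4 / 2 = 2\<close> from all four entries on the pair.\<close>

lemma psd_deflate_pair:
  fixes V :: "'v set"
  assumes b: "psd V b" and fin: "finite V" and uv: "u \<in> V" "v \<in> V" "u \<noteq> v"
    and vals: "b u u = 3" "b v v = 3" "b u v = 1"
    and opp: "\<And>x. x \<in> V \<Longrightarrow> x \<notin> {u, v} \<Longrightarrow> b x u = - b x v"
  shows "psd V (\<lambda>i j. b i j - (if i \<in> {u, v} \<and> j \<in> {u, v} then 2 else 0))"
  unfolding psd_def
proof (intro conjI ballI allI)
  let ?b = "\<lambda>i j. b i j - (if i \<in> {u, v} \<and> j \<in> {u, v} then 2 else 0)"
  show "?b j i = cnj (?b i j)" if "i \<in> V" "j \<in> V" for i j
    using psd_herm[OF b that] by auto
  have bvu: "b v u = 1" using psd_herm[OF b uv(1,2)] vals by simp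
  fix x :: "'v \<Rightarrow> complex"
  \<comment> \<open>\<open>c\<close> is the coefficient of \<open>x\<close> along
    \<open>u + v\<close>. Evaluating \<open>b\<close> after this component is removed bounds
    \<open>hform V b x\<close> below by the energy \<open>8 * (cmod c)\<^sup>2\<close> of the
    component.\<close>
  define c where "c = (x u + x v) / 2"
  let ?p = "\<lambda>i. if i \<in> {u, v} then - c else 0"
  have row: "b u j + b v j = (if j \<in> {u, v} then 4 else 0)" if "j \<in> V" for j
  proof (cases "j \<in> {u, v}")
    case False
    then show ?thesis
      using opp[OF that] psd_herm[OF b that uv(1)] psd_herm[OF b that uv(2)] by simp
  qed (use vals bvu in auto)
  have rows: "(\<Sum>j\<in>V. b u j * y j) + (\<Sum>j\<in>V. b v j * y j) = 4 * (y u + y v)" for y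
  proof -
    have "(\<Sum>j\<in>V. b u j * y j) + (\<Sum>j\<in>V. b v j * y j) = (\<Sum>j\<in>V. (b u j + b v j) * y j)"
      by (simp add: sum.distrib distrib_right)
    also have "\<dots> = (\<Sum>j\<in>V. if j \<in> {u, v} then 4 * y j else 0)"
      by (intro sum.cong refl) (simp add: row)
    also have "\<dots> = 4 * (y u + y v)"
      by (subst sum_over_pair[OF fin uv]) (simp add: distrib_left)
    finally show ?thesis .
  qed
  have pairing: "(\<Sum>i\<in>V. cnj (?p i) * (\<Sum>j\<in>V. b i j * y j)) = - cnj c * (4 * (y u + y v))" for y
  proof -
    have "(\<Sum>i\<in>V. cnj (?p i) * (\<Sum>j\<in>V. b i j * y j))
        = (\<Sum>i\<in>V. if i \<in> {u, v} then - cnj c * (\<Sum>j\<in>V. b i j * y j) else 0)"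
      by (intro sum.cong refl) simp
    also have "\<dots> = - cnj c * ((\<Sum>j\<in>V. b u j * y j) + (\<Sum>j\<in>V. b v j * y j))"
      by (subst sum_over_pair[OF fin uv]) (simp only: distrib_left)
    finally show ?thesis unfolding rows .
  qed
  have cc: "cnj c * c = of_real ((cmod c)\<^sup>2)" using cnj_mult_mult[of c 1] by simp
  have "0 \<le> Re (hform V b (\<lambda>i. x i + ?p i))" by (rule psd_nonneg[OF b])
  also have "\<dots> = Re (hform V b x) + 2 * Re (\<Sum>i\<in>V. cnj (?p i) * (\<Sum>j\<in>V. b i j * x j))
      + Re (hform V b ?p)"
    by (rule hform_add) (rule psd_herm[OF b])
  also have "(\<Sum>i\<in>V. cnj (?p i) * (\<Sum>j\<in>V. b i j * x j)) = of_real (- 8 * (cmod c)\<^sup>2)"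
  proof -
    have "x u + x v = 2 * c" by (simp add: c_def)
    then have "- cnj c * (4 * (x u + x v)) = - 8 * (cnj c * c)" by simp
    then show ?thesis unfolding pairing cc by simp
  qed
  also have "hform V b ?p = of_real (8 * (cmod c)\<^sup>2)"
  proof -
    have "hform V b ?p = (\<Sum>i\<in>V. cnj (?p i) * (\<Sum>j\<in>V. b i j * ?p j))"
      unfolding hform_def by (simp only: sum_distrib_left mult.assoc)
    also have "\<dots> = 8 * (cnj c * c)" unfolding pairing by simp
    finally show ?thesis unfolding cc by simp
  qed
  finally have "8 * (cmod c)\<^sup>2 \<le> Re (hform V b x)" by simp
  moreover have "hform V ?b x = hform V b x - of_real (8 * (cmod c)\<^sup>2)"
  proof -
    let ?q = "\<lambda>j. if j \<in> {u, v} then x j else 0"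
    have "hform V ?b x = hform V b x - (\<Sum>i\<in>V. \<Sum>j\<in>V. 2 * (cnj (?q i) * ?q j))"
      unfolding hform_def sum_subtractf[symmetric]
      by (intro sum.cong refl) (simp add: algebra_simps)
    also have "(\<Sum>i\<in>V. \<Sum>j\<in>V. 2 * (cnj (?q i) * ?q j)) = 2 * (cnj (\<Sum>i\<in>V. ?q i) * (\<Sum>j\<in>V. ?q j))"
      unfolding cnj_sum sum_product by (simp only: sum_distrib_left)
    also have "(\<Sum>i\<in>V. ?q i) = 2 * c"
      by (subst sum_over_pair[OF fin uv]) (simp add: c_def)
    also have "2 * (cnj (2 * c) * (2 * c)) = 8 * (cnj c * c)" by simp
    finally show ?thesis unfolding cc by simp
  qed
  ultimately show "0 \<le> Re (hform V ?b x)" by simp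
qed

section \<open>Caps\<close>

context cyclotomic_kernel
begin

definition cap :: "'v \<Rightarrow> 'v \<Rightarrow> bool" where
  "cap u v \<longleftrightarrow> u \<in> V \<and> v \<in> V \<and> u \<noteq> v \<and> a u u = 1 \<and> a v v = 1 \<and> a u v = 1"

lemma cap_sym: "cap u v \<Longrightarrow> cap v u"
  using herm[of u v] by (auto simp: cap_def)

text \<open>The form of \<open>2 - A\<close> vanishes at \<open>u + v\<close>, and the kernel
  equation in the row of \<open>x\<close> is the claim. In particular \<open>u\<close> and
  \<open>v\<close> have the same neighbours outside the cap.\<close>

lemma cap_opposite:
  assumes "cap u v" "x \<in> V" "x \<notin> {u, v}"
  shows "a x u = - a x v"
proof -
  define s where "s i = [u, v, x] ! i" for i :: nat
  have V: "u \<in> V" "v \<in> V" "u \<noteq> v" and vals: "a u u = 1" "a v v = 1" "a u v = 1" "a v u = 1"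
    using assms(1) cap_sym[OF assms(1)] by (auto simp: cap_def)
  have set: "{..2::nat} = {0, 1, 2}" by auto
  let ?b = "\<lambda>i j. shifted (-1) a (s i) (s j)"
  let ?c = "\<lambda>i::nat. if i < 2 then 1 else 0 :: complex"
  have "psd {..2} ?b"
    by (rule psd_pullback[OF psd_shifted finite_V]) (use V assms in \<open>auto simp: s_def set\<close>)
  moreover have "hform {..2} ?b ?c = 0"
    using V vals by (simp add: hform_def set s_def shifted_def)
  ultimately have "(\<Sum>j\<in>{..2}. ?b 2 j * ?c j) = 0" by (intro psd_null) auto
  then have "- a x u = a x v" using assms by (simp add: set s_def shifted_def)
  then show ?thesis by (metis minus_minus)
qed

text \<open>Deflation lowers the diagonal entry of \<open>2 + A\<close> at a cap vertex from 3 to 1,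
  its value in \<open>2 - A\<close>. A path ending in a cap vertex then has the same deficit in both
  forms.\<close>

lemma psd_two_caps:
  assumes c1: "cap u1 v1" and c2: "cap u2 v2" and disj: "{u1, v1} \<inter> {u2, v2} = {}"
  shows "psd V (\<lambda>i j. shifted 1 a i j - (if i \<in> {u1, v1} \<and> j \<in> {u1, v1} then 2 else 0)
      - (if i \<in> {u2, v2} \<and> j \<in> {u2, v2} then 2 else 0))"
proof (rule psd_deflate_pair)
  show "psd V (\<lambda>i j. shifted 1 a i j - (if i \<in> {u1, v1} \<and> j \<in> {u1, v1} then 2 else 0))"
  proof (rule psd_deflate_pair)
    show "psd V (shifted 1 a)" by (rule psd_shifted) simp
  qed (use c1 cap_opposite[OF c1] finite_V in \<open>auto simp: cap_def shifted_def\<close>)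
qed (use c2 disj cap_opposite[OF c2] finite_V in \<open>auto simp: cap_def shifted_def\<close>)

end

context connected_kernel
begin

context
  fixes u1 v1 u2 v2
  assumes c1: "cap u1 v1" and c2: "cap u2 v2" and disj: "{u1, v1} \<inter> {u2, v2} = {}"
begin

text \<open>\<open>v1\<close> shares its outside neighbours with \<open>u1\<close>, and
  \<open>v2\<close> with \<open>u2\<close>, so passing through \<open>v1\<close> or
  \<open>v2\<close> would be a detour on a shortest path.\<close>

lemma level_path_avoids_caps:
  assumes s: "level_path {u1} s m" "s m = u2" and i: "i \<le> m"
  shows "s i \<noteq> v1" "s i \<noteq> v2" "s i = u1 \<longleftrightarrow> i = 0" "s i = u2 \<longleftrightarrow> i = m"
proof -
  have V: "u1 \<in> V" "v1 \<in> V" "u2 \<in> V" "v2 \<in> V" "u1 \<noteq> v1" "u2 \<noteq> v2"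
    using c1 c2 by (auto simp: cap_def)
  have s0: "s 0 = u1" and edge: "\<And>i. i < m \<Longrightarrow> (s i, s (Suc i)) \<in> E"
    and sV: "\<And>i. i \<le> m \<Longrightarrow> s i \<in> V" and lev: "\<And>i. i \<le> m \<Longrightarrow> level {u1} (s i) = i"
    using s(1) by (auto simp: level_path_def)
  have le: "level {u1} w \<le> Suc (level {u1} v)" if "(v, w) \<in> E" for v w
    by (rule level_edge_le[OF _ _ that]) (use V in auto)
  show "s i = u1 \<longleftrightarrow> i = 0" "s i = u2 \<longleftrightarrow> i = m"
    using level_path_inj[OF s(1) i, of 0] level_path_inj[OF s(1) i, of m] s(2) s0 by auto
  show "s i \<noteq> v1"
  proof
    assume v: "s i = v1"
    then have im: "i < m" and i0: "0 < i" using i s(2) disj s0 V by (auto intro: le_neq_implies_less gr0I)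
    have e: "(v1, s (Suc i)) \<in> E" using edge[OF im] v by simp
    have ne: "s (Suc i) \<notin> {u1, v1}"
      using level_path_inj[OF s(1), of "Suc i" 0] level_path_inj[OF s(1), of "Suc i" i] im v s0 by auto
    have "a (s (Suc i)) u1 \<noteq> 0"
      using cap_opposite[OF c1 _ ne] E_sym[OF e] by (auto simp: edges_def)
    then have "(u1, s (Suc i)) \<in> E" using E_sym sV[of "Suc i"] im V by (auto simp: edges_def)
    then show False using le[of u1 "s (Suc i)"] lev[of 0] lev[of "Suc i"] s0 im i0 by simp
  qed
  show "s i \<noteq> v2"
  proof
    assume v: "s i = v2"
    then have im: "i < m" and i0: "0 < i" using i s(2) disj s0 V by (auto intro: le_neq_implies_less gr0I)
    then obtain k where k: "i = Suc k" by (cases i) auto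
    have e: "(s k, v2) \<in> E" using edge[of k] v im k by simp
    have ne: "s k \<notin> {u2, v2}"
      using level_path_inj[OF s(1), of k m] level_path_inj[OF s(1), of k i] im v s(2) k by auto
    have "a (s k) u2 \<noteq> 0"
      using cap_opposite[OF c2 _ ne] e by (auto simp: edges_def)
    then have "(s k, u2) \<in> E" using sV[of k] im k V by (auto simp: edges_def)
    then show False using le[of "s k" u2] lev[of k] lev[of m] s(2) im k by simp
  qed
qed

text \<open>
  The vector with entries of modulus one along the path, corrected at the caps, lies in the kernel
  of both \<open>2 - A\<close> and \<open>2 + A\<close>; the two kernel relations separate even from odd positions.
\<close>

lemma no_single_attachment:
  assumes s: "level_path {u1} s m" "s m = u2"
    and x: "x \<in> V" "x \<notin> s ` {..m}" "x \<notin> {v1, v2}"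
    and k: "k \<le> m" "(x, s k) \<in> E"
  obtains j where "j \<le> m" "j \<noteq> k" "even j = even k" "(x, s j) \<in> E"
proof -
  note found = that
  have V: "u1 \<in> V" "v1 \<in> V" "u2 \<in> V" "v2 \<in> V" "u1 \<noteq> v1" "u2 \<noteq> v2" "u1 \<noteq> u2"
    using c1 c2 disj by (auto simp: cap_def)
  have s0: "s 0 = u1" and edge: "\<And>i. i < m \<Longrightarrow> (s i, s (Suc i)) \<in> E"
    and sV: "\<And>i. i \<le> m \<Longrightarrow> s i \<in> V" and lev: "\<And>i. i \<le> m \<Longrightarrow> level {u1} (s i) = i"
    using s(1) by (auto simp: level_path_def)
  note avoid = level_path_avoids_caps[OF s]
  have m0: "m \<noteq> 0" using V s0 s(2) by metis
  obtain \<phi> where \<phi>: "\<And>i. cmod (\<phi> i) = 1"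
    "\<And>i. cnj (\<phi> i) * a (s i) (s (Suc i)) * \<phi> (Suc i) = of_real (cmod (a (s i) (s (Suc i))))"
    by (rule path_phases[of "\<lambda>i. a (s i) (s (Suc i))"]) (rule that)
  \<comment> \<open>The outside vertex \<open>x\<close> gets the extra index \<open>Suc m\<close>,
    where the test vector \<open>d\<close> is 0, so that its row of the kernel equation can be read
    off.\<close>
  define t where "t = s(Suc m := x)"
  define b where "b e i j = shifted e a i j - (if e = 1 \<and> i \<in> {u1, v1} \<and> j \<in> {u1, v1} then 2 else 0)
      - (if e = 1 \<and> i \<in> {u2, v2} \<and> j \<in> {u2, v2} then 2 else 0)" for e :: real and i j
  define B where "B e i j = b e (t i) (t j)" for e i j
  define c where "c e i = of_real ((- e) ^ i * 1) * \<phi> i" for e :: real and i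
  define d where "d e i = (if i \<le> m then c e i else 0)" for e i
  define w where "w i = cmod (a (s i) (s (Suc i)))" for i
  have psd_b: "psd V (b e)" if "e \<in> {1, -1}" for e
  proof (cases "e = 1")
    case True
    then have "b e = (\<lambda>i j. shifted 1 a i j - (if i \<in> {u1, v1} \<and> j \<in> {u1, v1} then 2 else 0)
      - (if i \<in> {u2, v2} \<and> j \<in> {u2, v2} then 2 else 0))"
      by (intro ext) (simp add: b_def)
    then show ?thesis using psd_two_caps[OF c1 c2 disj] by simp
  next
    case False
    then have "b e = shifted e a" by (intro ext) (simp add: b_def)
    then show ?thesis using psd_shifted[OF that] by simp
  qed
  have psd_B: "psd {..Suc m} (B e)" if "e \<in> {1, -1}" for e
    unfolding B_def by (rule psd_pullback[OF psd_b[OF that] finite_V]) (use sV x in \<open>auto simp: t_def\<close>)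
  have t: "t i = s i" if "i \<le> m" for i using that by (simp add: t_def)
  have offdiag: "B e i j = of_real e * a (s i) (s j)" if "i \<le> m" "j \<le> m" "i \<noteq> j" for e i j
  proof -
    have "s i \<noteq> s j" using level_path_inj[OF s(1) that(1,2)] that(3) by blast
    then show ?thesis using that avoid[OF that(1)] avoid[OF that(2)]
      by (auto simp: B_def t b_def shifted_def)
  qed
  have diag: "B e i i = 2 + of_real e * a (s i) (s i) - (if e = 1 \<and> i = 0 then 2 else 0)
      - (if e = 1 \<and> i = m then 2 else 0)" if "i \<le> m" for e i
    using that avoid[OF that] m0 by (auto simp: B_def t b_def shifted_def)
  have far: "B e i j = 0" if "j \<le> m" "i + 1 < j" for e i j
  proof -
    have "(s i, s j) \<notin> E"
    proof
      assume "(s i, s j) \<in> E"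
      then have "level {u1} (s j) \<le> Suc (level {u1} (s i))" by (intro level_edge_le) (use V in auto)
      then show False using lev that by simp
    qed
    then show ?thesis using offdiag[of i j e] that sV by (simp add: edges_def)
  qed
  have form: "Re (hform {..Suc m} (B e) (d e)) = (\<Sum>i\<le>m. Re (B e i i)) - 2 * (\<Sum>i<m. w i)"
    if e: "e \<in> {1, -1}" for e
  proof -
    have "hform {..Suc m} (B e) (d e) = hform {..m} (B e) (d e)"
      unfolding hform_def by (simp add: d_def)
    also have "\<dots> = hform {..m} (B e) (c e)" by (rule hform_cong) (simp_all add: d_def)
    also have "Re \<dots> = (\<Sum>i\<le>m. (1::real)\<^sup>2 * Re (B e i i))
        - 2 * (\<Sum>i<m. cmod (a (s i) (s (Suc i))) * 1 * 1)"
      unfolding c_def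
    proof (rule hform_path_phased[where w = "\<lambda>i. a (s i) (s (Suc i))", OF _ far e _ \<phi>])
      show "B e j i = cnj (B e i j)" if "i \<le> m" "j \<le> m" for i j
        by (rule psd_herm[OF psd_B[OF e]]) (use that in auto)
    qed (simp_all add: offdiag)
    finally show ?thesis by (simp add: w_def)
  qed
  \<comment> \<open>Adding the two forms eliminates the unknown charges inside the path. The
    diagonals amount to \<open>4 * m\<close> and the edges take away at least as much, so both
    values, being nonnegative, vanish.\<close>
  have "(\<Sum>i\<le>m. Re (B 1 i i)) + (\<Sum>i\<le>m. Re (B (-1) i i))
      = (\<Sum>i\<le>m. 4 - (if i = 0 then 2 else 0) - (if i = m then 2 else 0))"
    unfolding sum.distrib[symmetric] by (intro sum.cong refl) (simp add: diag)
  also have "\<dots> = 4 * real m" by (simp add: sum_subtractf)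
  finally have total: "(\<Sum>i\<le>m. Re (B 1 i i)) + (\<Sum>i\<le>m. Re (B (-1) i i)) = 4 * real m" .
  have "(\<Sum>i<m. 1) \<le> (\<Sum>i<m. w i)"
    unfolding w_def using edge by (intro sum_mono norm_ge_1) (auto simp: edges_def)
  then have "Re (hform {..Suc m} (B 1) (d 1)) + Re (hform {..Suc m} (B (-1)) (d (-1))) \<le> 0"
    using form[of 1] form[of "-1"] total by simp
  moreover have nn: "0 \<le> Re (hform {..Suc m} (B e) (d e))" if "e \<in> {1, -1}" for e
    by (rule psd_nonneg[OF psd_B[OF that]])
  ultimately have "Re (hform {..Suc m} (B 1) (d 1)) \<le> 0" "Re (hform {..Suc m} (B (-1)) (d (-1))) \<le> 0"
    using nn[OF insertI1] nn[OF insertI2[OF singletonI]] by linarith+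
  then have null: "Re (hform {..Suc m} (B e) (d e)) \<le> 0" if "e \<in> {1, -1}" for e
    using that by blast
  define z where "z j = a x (s j) * \<phi> j" for j
  have ker: "(\<Sum>j\<le>m. of_real ((- e) ^ j) * z j) = 0" if e: "e \<in> {1, -1}" for e
  proof -
    have xj: "B e (Suc m) j = of_real e * a x (s j)" if "j \<le> m" for j
      using x that s0 s(2) by (auto simp: B_def t_def b_def shifted_def)
    have "(\<Sum>j\<le>Suc m. B e (Suc m) j * d e j) = 0"
      by (rule psd_null[OF psd_B[OF e] _ null[OF e]]) simp_all
    then have "(\<Sum>j\<le>m. B e (Suc m) j * d e j) = 0" by (simp add: d_def)
    also have "(\<Sum>j\<le>m. B e (Suc m) j * d e j) = of_real e * (\<Sum>j\<le>m. of_real ((- e) ^ j) * z j)"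
      unfolding sum_distrib_left by (intro sum.cong refl) (simp add: xj d_def c_def z_def)
    finally show ?thesis using e by auto
  qed
  \<comment> \<open>The plain and the alternating sum of \<open>z\<close> both vanish; adding them
    with the sign \<open>(- 1) ^ k\<close> doubles the positions with the parity of \<open>k\<close>
    and cancels the others.\<close>
  have "(\<Sum>j\<le>m. (if even j = even k then 2 else 0) * z j)
      = (\<Sum>j\<le>m. of_real ((- (-1)) ^ j) * z j + (- 1) ^ k * (of_real ((- 1) ^ j) * z j))"
    by (intro sum.cong refl) (auto simp: minus_one_power_iff)
  also have "\<dots> = 0"
    unfolding sum.distrib sum_distrib_left[symmetric] using ker[of 1] ker[of "-1"] by simp
  finally have zero: "(\<Sum>j\<le>m. (if even j = even k then 2 else 0) * z j) = 0" .
  show ?thesis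
  proof (rule ccontr)
    assume "\<not> thesis"
    then have none: "(x, s j) \<notin> E" if "j \<le> m" "j \<noteq> k" "even j = even k" for j
      using found that by blast
    have "(\<Sum>j\<le>m. (if even j = even k then 2 else 0) * z j)
        = (\<Sum>j\<in>{k}. (if even j = even k then 2 else 0) * z j)"
      using none k x sV by (intro sum.mono_neutral_right) (auto simp: z_def edges_def)
    then have "z k = 0" using zero by simp
    then show False using k \<phi>(1)[of k] by (auto simp: z_def edges_def)
  qed
qed

text \<open>By connectedness it is enough that the right-hand side is closed under
  adjacency.\<close>

lemma two_caps_cover:
  assumes s: "level_path {u1} s m" "s m = u2"
  shows "V \<subseteq> s ` {..m} \<union> {v1, v2} \<union> (\<Union>i\<le>m. {x \<in> V. (s i, x) \<in> E})" (is "_ \<subseteq> ?C")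
proof -
  have V: "u1 \<in> V" "v1 \<in> V" "u2 \<in> V" "v2 \<in> V"
    using c1 c2 by (auto simp: cap_def)
  have s0: "s 0 = u1" and edge: "\<And>i. i < m \<Longrightarrow> (s i, s (Suc i)) \<in> E"
    and sV: "\<And>i. i \<le> m \<Longrightarrow> s i \<in> V" and lev: "\<And>i. i \<le> m \<Longrightarrow> level {u1} (s i) = i"
    using s(1) by (auto simp: level_path_def)
  have le: "level {u1} w \<le> Suc (level {u1} v) \<and> level {u1} v \<le> Suc (level {u1} w)"
    if "(v, w) \<in> E" for v w
    by (rule level_edge[OF _ _ that]) (use V in auto)
  have cap_nbr: "y \<in> {u, v} \<or> (u, y) \<in> E" if "cap u v" "(v, y) \<in> E" for u v y
    using cap_opposite[OF that(1), of y] E_sym[OF that(2)] E_sym[of y u] that(1)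
    by (auto simp: edges_def cap_def)
  have closed: "y \<in> ?C" if x: "x \<in> ?C" and xy: "(x, y) \<in> E" for x y
  proof (rule ccontr)
    assume y: "y \<notin> ?C"
    have yV: "y \<in> V" and xV: "x \<in> V" using xy by (auto simp: edges_def)
    have ysE: "(s i, y) \<notin> E" if "i \<le> m" for i using y yV that by auto
    have "x \<notin> s ` {..m}" using ysE xy by auto
    \<comment> \<open>A neighbour of \<open>v1\<close> or \<open>v2\<close> lies in the cap or is
      also a neighbour of the path end \<open>u1\<close> or \<open>u2\<close>.\<close>
    moreover have "x \<notin> {v1, v2}"
      using cap_nbr[OF c1, of y] cap_nbr[OF c2, of y] y xy ysE[of 0] ysE[of m] s0 s(2) by force
    ultimately obtain p where "p \<le> m" "(s p, x) \<in> E" using x by auto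
    then have p: "p \<le> m" "(x, s p) \<in> E" using E_sym by auto
    obtain q where q: "q \<le> m" "q \<noteq> p" "even q = even p" "(x, s q) \<in> E"
      using no_single_attachment[OF s xV \<open>x \<notin> s ` {..m}\<close> \<open>x \<notin> {v1, v2}\<close> p] by blast
    define r where "r = min p q"
    have "level {u1} x \<le> Suc p" "p \<le> Suc (level {u1} x)"
      "level {u1} x \<le> Suc q" "q \<le> Suc (level {u1} x)"
      using le[OF p(2)] le[OF q(4)] lev p q by simp_all
    \<comment> \<open>Both positions are within one level of \<open>x\<close>, distinct and of equal
      parity, which leaves a difference of exactly 2.\<close>
    then have "max p q = r + 2 \<and> level {u1} x = Suc r"
      using q(2,3) unfolding r_def by presburger
    then have r: "r + 2 \<le> m" "(s r, x) \<in> E" "(x, s (r + 2)) \<in> E" "level {u1} x = Suc r"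
      using p q E_sym unfolding r_def by (auto simp: max_def min_def split: if_splits)
    define t where "t = s(Suc r := x)"
    have "level_path {u1} t m"
      unfolding level_path_def
    proof (intro conjI allI impI)
      show "(t i, t (Suc i)) \<in> E" if "i < m" for i
        using edge[OF that] r by (auto simp: t_def)
    qed (use s0 sV lev r xV in \<open>auto simp: t_def\<close>)
    moreover have "t m = u2" using r s(2) by (simp add: t_def)
    moreover have "y \<notin> t ` {..m}" using y xy \<open>x \<notin> s ` {..m}\<close> r ysE by (auto simp: t_def split: if_splits)
    moreover have "(y, t (Suc r)) \<in> E" using E_sym[OF xy] by (simp add: t_def)
    moreover have "y \<notin> {v1, v2}" "Suc r \<le> m" using y r(1) by auto
    \<comment> \<open>Away from \<open>Suc r\<close> the new path agrees with \<open>s\<close>, so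
      the second attachment makes \<open>y\<close> a neighbour of the old path.\<close>
    ultimately obtain j where "j \<le> m" "j \<noteq> Suc r" "(y, t j) \<in> E"
      using no_single_attachment[of t m y "Suc r"] yV by blast
    then show False using ysE[of j] E_sym by (auto simp: t_def)
  qed
  show ?thesis
  proof
    fix y assume "y \<in> V"
    then have "(u1, y) \<in> E\<^sup>*" using connected V by blast
    then show "y \<in> ?C"
    proof (induction rule: rtrancl_induct)
      case base
      then show ?case using s0 by auto
    qed (rule closed)
  qed
qed

text \<open>The count is \<open>m + 1\<close> path vertices, the two vertices \<open>v1\<close> and
  \<open>v2\<close>, and four neighbours for each path vertex. A walk of length \<open>k\<close>
  replaces the distance \<open>m\<close> because a walk persists in every larger graph, while the
  distance may shrink.\<close>

lemma two_caps_card_le: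
  assumes "(u1, u2) \<in> E ^^ k"
  shows "card V \<le> 5 * k + 7"
proof -
  let ?m = "level {u1} u2"
  have V: "u1 \<in> V" "u2 \<in> V" using c1 c2 by (auto simp: cap_def)
  have m: "?m \<le> k" by (rule level_le[OF _ assms]) simp
  obtain s where s: "level_path {u1} s ?m" "s ?m = u2"
    using level_path_exists[of "{u1}" u2] V by blast
  let ?N = "\<lambda>i. {x \<in> V. (s i, x) \<in> E}"
  have "card V \<le> card (s ` {..?m} \<union> {v1, v2} \<union> (\<Union>i\<le>?m. ?N i))"
    using two_caps_cover[OF s] finite_V by (intro card_mono) auto
  also have "\<dots> \<le> card (s ` {..?m}) + card {v1, v2} + card (\<Union>i\<le>?m. ?N i)"
    by (meson card_Un_le add_le_mono1 le_trans)
  also have "card (\<Union>i\<le>?m. ?N i) \<le> (\<Sum>i\<le>?m. card (?N i))" by (rule card_UN_le) simp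
  also have "\<dots> \<le> (\<Sum>i\<le>?m. 4)"
    by (intro sum_mono degree_le_4) (use s in \<open>auto simp: level_path_def\<close>)
  also have "card (s ` {..?m}) \<le> Suc ?m" using card_image_le[of "{..?m}" s] by simp
  also have "card {v1, v2} \<le> 2" by (simp add: card_insert_le_m1)
  finally show ?thesis using m by simp
qed

end

end

section \<open>Capping a long path\<close>

text \<open>The path is cut after \<open>p - 1\<close>; \<open>p\<close> and \<open>Suc p\<close>
  carry the cap. The opposite signs of the two new edges couple the rest of the graph only to the
  difference of the values at the cap.\<close>

definition capped :: "nat \<Rightarrow> (nat \<Rightarrow> nat \<Rightarrow> complex) \<Rightarrow> nat \<Rightarrow> nat \<Rightarrow> complex" where
  "capped p a i j =
     (if i < p \<and> j < p then a i j
      else if p \<le> i \<and> p \<le> j then 1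
      else if (i, j) = (p - 1, p) \<or> (i, j) = (p, p - 1) then 1
      else if (i, j) = (p - 1, Suc p) \<or> (i, j) = (Suc p, p - 1) then - 1
      else 0)"

text \<open>Summation by parts: the left side is the squared first value 1, plus \<open>n\<close>
  squared increments \<open>1 / W\<^sup>2\<close>, plus the squared last value.\<close>

lemma ramp_energy:
  assumes "0 < W"
  shows "(\<Sum>i<Suc n. 2 * (1 - real i / W)\<^sup>2)
      - 2 * (\<Sum>i<n. (1 - real i / W) * (1 - real (Suc i) / W))
    = 1 + real n / W\<^sup>2 + (1 - real n / W)\<^sup>2"
proof (induction n)
  case (Suc n)
  have "2 * (1 - real (Suc n) / W)\<^sup>2 - 2 * ((1 - real n / W) * (1 - real (Suc n) / W))
      = 1 / W\<^sup>2 + (1 - real (Suc n) / W)\<^sup>2 - (1 - real n / W)\<^sup>2"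
    using assms by (simp add: field_simps power2_eq_square)
  then show ?case using Suc.IH by (simp add: add_divide_distrib)
qed simp

text \<open>
  A long tail of uncharged edges of weight 1 carries, up to an error \<open>1 / W\<close>, a vector of
  energy 1 in both forms \<open>2 - A\<close> and \<open>2 + A\<close>.
\<close>

lemma tail_inequality:
  assumes A: "cyclotomic_kernel {..<p + W} A" and p: "0 < p" and W: "0 < W"
    and far: "\<And>i j. p \<le> j \<Longrightarrow> j < p + W \<Longrightarrow> i + 1 < j \<Longrightarrow> A i j = 0"
    and edge: "\<And>i. i < W \<Longrightarrow> cmod (A (p + i - 1) (p + i)) = 1"
    and diag: "\<And>i. i < W \<Longrightarrow> A (p + i) (p + i) = 0"
    and e: "e \<in> {1, -1}"
  shows "0 \<le> Re (hform {..<p} (shifted e A) x) + (cmod t)\<^sup>2 * (1 + 1 / real W)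
    + 2 * e * Re (cnj (x (p - 1)) * t)"
proof -
  interpret cyclotomic_kernel "{..<p + W}" A by fact
  define w where "w i = A (p + i - 1) (p + i)" for i
  obtain \<phi> :: "nat \<Rightarrow> complex" where \<phi>: "\<phi> 0 = 1" "\<And>i. cmod (\<phi> i) = 1"
    "\<And>i. cnj (\<phi> i) * w i * \<phi> (Suc i) = of_real (cmod (w i))"
    by (rule path_phases[of w]) (rule that)
  define g where "g i = 1 - real i / real W" for i
  \<comment> \<open>The tail carries \<open>t\<close> times a ramp falling from 1 to
    \<open>1 / W\<close>. The phases are shifted by one because edge 0 joins the core to the tail:
    its phase is absorbed at the first tail vertex, and \<open>x (p - 1)\<close> stays
    untouched.\<close>
  define c where "c i = (if i < p then x i
      else t * of_real ((- e) ^ (i - p) * g (i - p)) * \<phi> (Suc (i - p)))" for i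
  have ee: "e * e = 1" using e by auto
  have pow: "(- e) ^ i * (- e) ^ i = 1" for i
    using ee by (simp add: power_mult_distrib[symmetric])
  obtain n where n: "W = Suc n" using W by (cases W) auto
  have head: "Re (cnj (c (p - 1)) * shifted e A (p - 1) p * c p) = e * Re (cnj (x (p - 1)) * t)"
  proof -
    have "w 0 * \<phi> 1 = 1" using \<phi>(3)[of 0] \<phi>(1) edge[of 0] W by (simp add: w_def)
    moreover have "p - Suc 0 \<noteq> p" using p by simp
    ultimately have "cnj (c (p - 1)) * shifted e A (p - 1) p * c p = of_real e * (cnj (x (p - 1)) * t)"
      using p by (simp add: c_def g_def shifted_def w_def mult_ac)
    then show ?thesis by simp
  qed
  have body: "Re (cnj (c (p + i)) * shifted e A (p + i) (p + Suc i) * c (p + Suc i))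
      = - (cmod t)\<^sup>2 * (g i * g (Suc i))" if "i < n" for i
  proof -
    have "cnj (c (p + i)) * shifted e A (p + i) (p + Suc i) * c (p + Suc i)
        = (t * cnj t) * of_real (- (e * e) * ((- e) ^ i * (- e) ^ i) * (g i * g (Suc i)))
          * (cnj (\<phi> (Suc i)) * w (Suc i) * \<phi> (Suc (Suc i)))"
      by (simp add: c_def shifted_def w_def mult_ac)
    also have "\<dots> = of_real (- (cmod t)\<^sup>2 * (g i * g (Suc i)))"
      unfolding \<phi>(3) pow ee complex_norm_square[symmetric]
      using edge[of "Suc i"] that n by (simp add: w_def)
    finally show ?thesis by (simp only: Re_complex_of_real)
  qed
  have size: "(cmod (c (p + i)))\<^sup>2 * Re (shifted e A (p + i) (p + i)) = (cmod t)\<^sup>2 * (2 * (g i)\<^sup>2)"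
    if "i < W" for i
  proof -
    have "(cmod (c (p + i)))\<^sup>2 = (cmod t)\<^sup>2 * (g i)\<^sup>2"
      using e by (auto simp: c_def norm_mult \<phi>(2) norm_power power_mult_distrib abs_mult power_abs)
    then show ?thesis using diag[OF that] by (simp add: shifted_def)
  qed
  have "0 \<le> Re (hform {..<p + W} (shifted e A) c)" by (rule psd_nonneg[OF psd_shifted[OF e]])
  also have "\<dots> = Re (hform {..<p} (shifted e A) c)
     + (\<Sum>i<W. (cmod (c (p + i)))\<^sup>2 * Re (shifted e A (p + i) (p + i))
            + 2 * Re (cnj (c (p + i - 1)) * shifted e A (p + i - 1) (p + i) * c (p + i)))"
  proof (rule hform_extend_path[OF _ _ p])
    show "shifted e A j i = cnj (shifted e A i j)" if "i < p + W" "j < p + W" for i j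
      by (rule psd_herm[OF psd_shifted[OF e]]) (use that in auto)
  qed (auto simp: shifted_def far)
  also have "hform {..<p} (shifted e A) c = hform {..<p} (shifted e A) x"
    by (rule hform_cong) (simp_all add: c_def)
  also have "(\<Sum>i<W. (cmod (c (p + i)))\<^sup>2 * Re (shifted e A (p + i) (p + i))
            + 2 * Re (cnj (c (p + i - 1)) * shifted e A (p + i - 1) (p + i) * c (p + i)))
      = (\<Sum>i<W. (cmod t)\<^sup>2 * (2 * (g i)\<^sup>2))
        + 2 * (\<Sum>i<W. Re (cnj (c (p + i - 1)) * shifted e A (p + i - 1) (p + i) * c (p + i)))"
    unfolding sum.distrib sum_distrib_left by (simp add: size)
  also have "(\<Sum>i<W. Re (cnj (c (p + i - 1)) * shifted e A (p + i - 1) (p + i) * c (p + i)))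
      = e * Re (cnj (x (p - 1)) * t) - (cmod t)\<^sup>2 * (\<Sum>i<n. g i * g (Suc i))"
    unfolding n sum.lessThan_Suc_shift using head body
    by (simp add: sum_distrib_left sum_negf)
  also have "(\<Sum>i<W. (cmod t)\<^sup>2 * (2 * (g i)\<^sup>2)) = (cmod t)\<^sup>2 * (\<Sum>i<W. 2 * (g i)\<^sup>2)"
    by (simp only: sum_distrib_left)
  finally have "0 \<le> Re (hform {..<p} (shifted e A) x) + 2 * e * Re (cnj (x (p - 1)) * t)
      + (cmod t)\<^sup>2 * ((\<Sum>i<W. 2 * (g i)\<^sup>2) - 2 * (\<Sum>i<n. g i * g (Suc i)))"
    by (simp add: algebra_simps)
  also have "(\<Sum>i<W. 2 * (g i)\<^sup>2) - 2 * (\<Sum>i<n. g i * g (Suc i)) = 1 + 1 / real W"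
  proof -
    have "(\<Sum>i<W. 2 * (g i)\<^sup>2) - 2 * (\<Sum>i<n. g i * g (Suc i))
        = 1 + real n / (real W)\<^sup>2 + (1 - real n / real W)\<^sup>2"
      unfolding n g_def by (rule ramp_energy) simp
    also have "\<dots> = 1 + 1 / real W"
    proof -
      have "(r - 1) / r\<^sup>2 + (1 - (r - 1) / r)\<^sup>2 = 1 / r" if "0 < r" for r :: real
        using that by (simp add: field_simps power2_eq_square)
      from this[of "real W"] show ?thesis using W n by simp
    qed
    finally show ?thesis .
  qed
  finally show ?thesis by (simp add: algebra_simps)
qed

text \<open>With \<open>t = y p - y (Suc p)\<close>, all but the last term is the limit of the bound
  in \<open>tail_inequality\<close> for large \<open>W\<close>. The last term is the share of the
  eigenvector that splits off: it vanishes in \<open>2 - A\<close> and is nonnegative in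
  \<open>2 + A\<close>.\<close>

lemma hform_capped:
  assumes p: "0 < p"
  shows "Re (hform {..<p + 2} (shifted e (capped p a)) y)
    = Re (hform {..<p} (shifted e a) y) + (cmod (y p - y (Suc p)))\<^sup>2
      + 2 * e * Re (cnj (y (p - 1)) * (y p - y (Suc p)))
      + (1 + e) * (cmod (y p + y (Suc p)))\<^sup>2"
proof -
  let ?b = "shifted e (capped p a)"
  have old: "?b i j = shifted e a i j" if "i < p" "j < p" for i j
    using that by (simp add: shifted_def capped_def)
  have colp: "(\<Sum>i<p. cnj (y i) * ?b i p * y p) = of_real e * (cnj (y (p - 1)) * y p)"
  proof -
    have "(\<Sum>i<p. cnj (y i) * ?b i p * y p) = (\<Sum>i\<in>{p - 1}. cnj (y i) * ?b i p * y p)"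
      using p by (intro sum.mono_neutral_right) (auto simp: shifted_def capped_def)
    then show ?thesis using p by (simp add: shifted_def capped_def)
  qed
  have colq: "(\<Sum>i<p. cnj (y i) * ?b i (Suc p) * y (Suc p)) = - of_real e * (cnj (y (p - 1)) * y (Suc p))"
  proof -
    have "(\<Sum>i<p. cnj (y i) * ?b i (Suc p) * y (Suc p))
        = (\<Sum>i\<in>{p - 1}. cnj (y i) * ?b i (Suc p) * y (Suc p))"
      using p by (intro sum.mono_neutral_right) (auto simp: shifted_def capped_def)
    then show ?thesis using p by (simp add: shifted_def capped_def)
  qed
  have rowp: "(\<Sum>j<p. cnj (y p) * ?b p j * y j) = of_real e * (cnj (y p) * y (p - 1))"
  proof -
    have "(\<Sum>j<p. cnj (y p) * ?b p j * y j) = (\<Sum>j\<in>{p - 1}. cnj (y p) * ?b p j * y j)"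
      using p by (intro sum.mono_neutral_right) (auto simp: shifted_def capped_def)
    then show ?thesis using p by (simp add: shifted_def capped_def)
  qed
  have rowq: "(\<Sum>j<p. cnj (y (Suc p)) * ?b (Suc p) j * y j) = - of_real e * (cnj (y (Suc p)) * y (p - 1))"
  proof -
    have "(\<Sum>j<p. cnj (y (Suc p)) * ?b (Suc p) j * y j)
        = (\<Sum>j\<in>{p - 1}. cnj (y (Suc p)) * ?b (Suc p) j * y j)"
      using p by (intro sum.mono_neutral_right) (auto simp: shifted_def capped_def)
    then show ?thesis using p by (simp add: shifted_def capped_def)
  qed
  have corner: "?b p p = 2 + of_real e" "?b (Suc p) (Suc p) = 2 + of_real e"
    "?b p (Suc p) = of_real e" "?b (Suc p) p = of_real e"
    by (simp_all add: shifted_def capped_def)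
  have identity: "Re (of_real e * (cnj z * u)) + Re (- of_real e * (cnj z * v))
      + Re (of_real e * (cnj u * z)) + Re (- of_real e * (cnj v * z))
      + Re (cnj u * (2 + of_real e) * u) + Re (cnj v * (2 + of_real e) * v)
      + Re (cnj u * of_real e * v) + Re (cnj v * of_real e * u)
      = (cmod (u - v))\<^sup>2 + 2 * e * Re (cnj z * (u - v)) + (1 + e) * (cmod (u + v))\<^sup>2"
    for z u v :: complex
    unfolding cmod_power2 by (simp add: algebra_simps power2_eq_square)
  have set: "{..<p + 2} = insert (Suc p) (insert p {..<p})" by auto
  have "hform {..<p + 2} ?b y = hform {..<p} ?b y
      + (\<Sum>i<p. cnj (y i) * ?b i p * y p) + (\<Sum>i<p. cnj (y i) * ?b i (Suc p) * y (Suc p))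
      + (\<Sum>j<p. cnj (y p) * ?b p j * y j) + (\<Sum>j<p. cnj (y (Suc p)) * ?b (Suc p) j * y j)
      + cnj (y p) * ?b p p * y p + cnj (y (Suc p)) * ?b (Suc p) (Suc p) * y (Suc p)
      + cnj (y p) * ?b p (Suc p) * y (Suc p) + cnj (y (Suc p)) * ?b (Suc p) p * y p"
    unfolding hform_def set by (simp add: sum.distrib)
  also have "hform {..<p} ?b y = hform {..<p} (shifted e a) y"
    by (rule hform_cong) (simp_all add: old)
  finally have "Re (hform {..<p + 2} ?b y) = Re (hform {..<p} (shifted e a) y)
     + (Re (of_real e * (cnj (y (p - 1)) * y p)) + Re (- of_real e * (cnj (y (p - 1)) * y (Suc p)))
      + Re (of_real e * (cnj (y p) * y (p - 1))) + Re (- of_real e * (cnj (y (Suc p)) * y (p - 1)))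
      + Re (cnj (y p) * (2 + of_real e) * y p) + Re (cnj (y (Suc p)) * (2 + of_real e) * y (Suc p))
      + Re (cnj (y p) * of_real e * y (Suc p)) + Re (cnj (y (Suc p)) * of_real e * y p))"
    unfolding colp colq rowp rowq corner by (simp only: plus_complex.sel add.assoc)
  also have "\<dots> = Re (hform {..<p} (shifted e a) y) + ((cmod (y p - y (Suc p)))\<^sup>2
      + 2 * e * Re (cnj (y (p - 1)) * (y p - y (Suc p)))
      + (1 + e) * (cmod (y p + y (Suc p)))\<^sup>2)"
    unfolding identity ..
  finally show ?thesis by simp
qed

lemma nonneg_of_inverse_perturbation:
  fixes h c :: real
  assumes "infinite S" "\<And>W. W \<in> S \<Longrightarrow> 0 < W \<Longrightarrow> 0 \<le> h + c / real W"
  shows "0 \<le> h"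
proof (rule ccontr)
  assume "\<not> 0 \<le> h"
  then obtain N :: nat where N: "\<bar>c\<bar> < real N * (- h)" using ex_less_of_nat_mult[of "- h" "\<bar>c\<bar>"] by auto
  obtain W where W: "W \<in> S" "Suc N < W" using assms(1) by (meson infinite_nat_iff_unbounded)
  then have "0 \<le> h * real W + c" using assms(2)[of W] by (simp add: field_simps)
  moreover have "real N * (- h) \<le> real W * (- h)" using W \<open>\<not> 0 \<le> h\<close> by (intro mult_right_mono) auto
  ultimately show False using N by (simp add: algebra_simps)
qed

lemma capped_cyclotomic_kernel:
  assumes a: "cyclotomic_kernel {..<p} a" and p: "0 < p" and S: "infinite S"
    and tail: "\<And>W. W \<in> S \<Longrightarrow> \<exists>A. cyclotomic_kernel {..<p + W} A
      \<and> (\<forall>i<p. \<forall>j<p. A i j = a i j)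
      \<and> (\<forall>i j. p \<le> j \<longrightarrow> j < p + W \<longrightarrow> i + 1 < j \<longrightarrow> A i j = 0)
      \<and> (\<forall>i<W. cmod (A (p + i - 1) (p + i)) = 1) \<and> (\<forall>i<W. A (p + i) (p + i) = 0)"
  shows "cyclotomic_kernel {..<p + 2} (capped p a)"
proof -
  interpret a: cyclotomic_kernel "{..<p}" a by fact
  have ineq: "0 \<le> Re (hform {..<p} (shifted e a) x) + (cmod t)\<^sup>2 + 2 * e * Re (cnj (x (p - 1)) * t)"
    if e: "e \<in> {1, -1}" for e x t
  proof (rule nonneg_of_inverse_perturbation[OF S])
    fix W :: nat assume "W \<in> S" and W: "0 < W"
    then obtain A where A: "cyclotomic_kernel {..<p + W} A" "\<And>i j. i < p \<Longrightarrow> j < p \<Longrightarrow> A i j = a i j"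
      "\<And>i j. p \<le> j \<Longrightarrow> j < p + W \<Longrightarrow> i + 1 < j \<Longrightarrow> A i j = 0"
      "\<And>i. i < W \<Longrightarrow> cmod (A (p + i - 1) (p + i)) = 1" "\<And>i. i < W \<Longrightarrow> A (p + i) (p + i) = 0"
      using tail[OF \<open>W \<in> S\<close>] by (elim exE conjE) simp
    have "hform {..<p} (shifted e A) x = hform {..<p} (shifted e a) x"
      by (rule hform_cong) (simp_all add: shifted_def A(2))
    then show "0 \<le> Re (hform {..<p} (shifted e a) x) + (cmod t)\<^sup>2
        + 2 * e * Re (cnj (x (p - 1)) * t) + (cmod t)\<^sup>2 / real W"
      using tail_inequality[OF A(1) p W A(3-5) e, of x t] by (simp add: algebra_simps)
  qed
  show ?thesis
  proof
    show "psd {..<p + 2} (shifted e (capped p a))" if e: "e \<in> {1, -1}" for e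
      unfolding psd_def
    proof (intro conjI ballI allI)
      show "shifted e (capped p a) j i = cnj (shifted e (capped p a) i j)" for i j
        by (cases "i < p"; cases "j < p") (use a.herm[of i j] in \<open>auto simp: shifted_def capped_def\<close>)
      show "0 \<le> Re (hform {..<p + 2} (shifted e (capped p a)) y)" for y
      proof -
        have "0 \<le> (1 + e) * (cmod (y p + y (Suc p)))\<^sup>2" using e by auto
        then show ?thesis
          using hform_capped[OF p, where a = a and y = y] ineq[OF e, of y "y p - y (Suc p)"] by simp
      qed
    qed
    show "capped p a i i \<in> {0, 1, -1}" if "i \<in> {..<p + 2}" for i
      using a.charge[of i] by (auto simp: capped_def)
    show "capped p a i j = 0 \<or> (cmod (capped p a i j))\<^sup>2 \<in> {1, 2, 3, 4}"
      if "i \<in> {..<p + 2}" "j \<in> {..<p + 2}" "i \<noteq> j" for i j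
      using a.weight[of i j] that by (auto simp: capped_def)
  qed simp
qed

text \<open>The vertex \<open>s 0\<close> is skipped: it lies in the range of \<open>f\<close>.\<close>

definition attach :: "nat \<Rightarrow> (nat \<Rightarrow> 'v) \<Rightarrow> (nat \<Rightarrow> 'v) \<Rightarrow> nat \<Rightarrow> 'v" where
  "attach n f s i = (if i < n then f i else s (i - n + 1))"

section \<open>Long tails inside large graphs\<close>

context connected_kernel
begin

lemma attach_props:
  assumes f: "inj_on f {..<n}" "f ` {..<n} \<subseteq> V" and n: "0 < n"
    and s: "level_path (f ` {..<n}) s m" and m: "W + 20 \<le> m"
  defines "h \<equiv> attach n f s" and "p \<equiv> n + 10"
  shows "inj_on h {..<p + W}" "h ` {..<p + W} \<subseteq> V"
    and "\<And>i j. p \<le> j \<Longrightarrow> j < p + W \<Longrightarrow> i + 1 < j \<Longrightarrow> a (h i) (h j) = 0"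
    and "\<And>i. i < W \<Longrightarrow> cmod (a (h (p + i - 1)) (h (p + i))) = 1"
    and "\<And>i. i < W \<Longrightarrow> a (h (p + i)) (h (p + i)) = 0"
    and "\<And>i. n \<le> i \<Longrightarrow> i < p + W \<Longrightarrow> \<exists>j<i. a (h i) (h j) \<noteq> 0"
proof -
  let ?X = "f ` {..<n}"
  have X: "?X \<subseteq> V" "?X \<noteq> {}" using f n by auto
  have s0: "s 0 \<in> ?X" and edge: "\<And>i. i < m \<Longrightarrow> (s i, s (Suc i)) \<in> E"
    and sV: "\<And>i. i \<le> m \<Longrightarrow> s i \<in> V" and lev: "\<And>i. i \<le> m \<Longrightarrow> level ?X (s i) = i"
    using s by (auto simp: level_path_def)
  have h_lev: "level ?X (h i) = (if i < n then 0 else i - n + 1)" and hV: "h i \<in> V"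
    if "i < p + W" for i
    using that lev[of "i - n + 1"] sV[of "i - n + 1"] level_zero_iff[OF X, of "h i"] f m
    by (auto simp: h_def attach_def p_def)
  show "h ` {..<p + W} \<subseteq> V" using hV by auto
  show "inj_on h {..<p + W}"
  proof (rule inj_onI)
    fix i j assume ij: "i \<in> {..<p + W}" "j \<in> {..<p + W}" and eq: "h i = h j"
    then have "(if i < n then 0 else i - n + 1) = (if j < n then 0 else j - n + 1)"
      using h_lev[of i] h_lev[of j] by simp
    then show "i = j" using eq f(1) by (auto simp: h_def attach_def inj_on_def split: if_splits)
  qed
  show "a (h i) (h j) = 0" if "p \<le> j" "j < p + W" "i + 1 < j" for i j
  proof (rule ccontr)
    assume "a (h i) (h j) \<noteq> 0"
    then have "(h i, h j) \<in> E" using hV that by (auto simp: edges_def)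
    then have "level ?X (h j) \<le> Suc (level ?X (h i))" by (rule level_edge_le[OF X])
    then show False using h_lev[of i] h_lev[of j] that by (auto simp: p_def split: if_splits)
  qed
  \<comment> \<open>\<open>path_centre\<close> is applied to a window with ten path vertices on
    either side of \<open>s k\<close>. Since \<open>h (p + i)\<close> is \<open>s (11 + i)\<close>,
    the offset 10 in \<open>p\<close> and the bound \<open>W + 20 \<le> m\<close> provide exactly
    this room.\<close>
  have centre: "cmod (a (s k) (s (Suc k))) = 1 \<and> a (s k) (s k) = 0" if k: "10 \<le> k" "k + 10 \<le> m" for k
  proof -
    let ?t = "\<lambda>i. s (k - 10 + i)"
    have "cyclotomic_kernel {..20} (\<lambda>i j. a (?t i) (?t j))"
    proof (rule pullback)
      show "inj_on ?t {..20}"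
      proof (rule inj_onI)
        fix x y assume "x \<in> {..20}" "y \<in> {..20}" and eq: "?t x = ?t y"
        then have "k - 10 + x \<le> m" "k - 10 + y \<le> m" using k by auto
        from level_path_inj[OF s this eq] show "x = y" by simp
      qed
    qed (use sV k in auto)
    moreover have "a (?t i) (?t j) = 0" if "j \<le> 20" "i + 1 < j" for i j
    proof (rule ccontr)
      assume "a (?t i) (?t j) \<noteq> 0"
      then have "(?t i, ?t j) \<in> E" using sV that k by (auto simp: edges_def)
      then have "level ?X (?t j) \<le> Suc (level ?X (?t i))" by (rule level_edge_le[OF X])
      then show False using lev[of "k - 10 + i"] lev[of "k - 10 + j"] that k by simp
    qed
    moreover have "a (?t i) (?t (Suc i)) \<noteq> 0" if "i < 20" for i
      using edge[of "k - 10 + i"] that k by (simp add: edges_def)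
    ultimately have "cmod (a (?t 10) (?t 11)) = 1" "a (?t 10) (?t 10) = 0"
      using path_centre[of "\<lambda>i j. a (?t i) (?t j)"] by blast+
    moreover have "k - 10 + 10 = k" "k - 10 + 11 = Suc k" using k by auto
    ultimately show ?thesis by simp
  qed
  show "cmod (a (h (p + i - 1)) (h (p + i))) = 1" if "i < W" for i
    using centre[of "10 + i"] that m by (simp add: h_def attach_def p_def)
  show "a (h (p + i)) (h (p + i)) = 0" if "i < W" for i
    using centre[of "11 + i"] that m by (simp add: h_def attach_def p_def)
  show "\<exists>j<i. a (h i) (h j) \<noteq> 0" if i: "n \<le> i" "i < p + W" for i
  proof (cases "i = n")
    case True
    obtain j where j: "j < n" "f j = s 0" using s0 by auto
    have "(s 1, s 0) \<in> E" using edge[of 0] m E_sym by simp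
    then show ?thesis using j True by (intro exI[of _ j]) (simp add: h_def attach_def edges_def)
  next
    case False
    have e: "(s (i - n + 1), s (i - n)) \<in> E" using edge[of "i - n"] m i E_sym by (simp add: p_def)
    have "i - 1 - n + 1 = i - n" using i False by simp
    then have "a (h i) (h (i - 1)) \<noteq> 0" using e i False by (auto simp: h_def attach_def edges_def)
    then show ?thesis using i False n by (intro exI[of _ "i - 1"]) auto
  qed
qed

end

definition connected_on :: "'v set \<Rightarrow> ('v \<Rightarrow> 'v \<Rightarrow> complex) \<Rightarrow> bool" where
  "connected_on V a \<longleftrightarrow> (\<forall>i\<in>V. \<forall>j\<in>V. (i, j) \<in> (edges V a)\<^sup>*)"

lemma connected_on_extend:
  fixes n q :: nat
  assumes conn: "connected_on {..<n} a" and n: "0 < n"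
    and eq: "\<And>i j. i < n \<Longrightarrow> j < n \<Longrightarrow> b i j = a i j" and nq: "n \<le> q"
    and herm: "\<And>i j. i < q \<Longrightarrow> j < q \<Longrightarrow> b j i = cnj (b i j)"
    and new: "\<And>i. n \<le> i \<Longrightarrow> i < q \<Longrightarrow> \<exists>j<i. b i j \<noteq> 0"
  shows "connected_on {..<q} b"
proof -
  have sub: "edges {..<n} a \<subseteq> edges {..<q} b" using eq nq by (auto simp: edges_def)
  have sym: "sym (edges {..<q} b)"
  proof (rule symI)
    fix i j assume "(i, j) \<in> edges {..<q} b"
    then show "(j, i) \<in> edges {..<q} b" using herm[of i j] by (auto simp: edges_def)
  qed
  have root: "(i, 0) \<in> (edges {..<q} b)\<^sup>*" if "i < q" for i
    using that
  proof (induction i rule: less_induct)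
    case (less i)
    show ?case
    proof (cases "i < n")
      case True
      then have "(i, 0) \<in> (edges {..<n} a)\<^sup>*" using conn n by (auto simp: connected_on_def)
      then show ?thesis using rtrancl_mono[OF sub] by blast
    next
      case False
      then obtain j where j: "j < i" "b i j \<noteq> 0" using new[of i] less.prems by auto
      then have "(i, j) \<in> edges {..<q} b" "(j, 0) \<in> (edges {..<q} b)\<^sup>*"
        using less by (auto simp: edges_def)
      then show ?thesis by (rule converse_rtrancl_into_rtrancl)
    qed
  qed
  show ?thesis
    unfolding connected_on_def
  proof (intro ballI)
    fix i j assume "i \<in> {..<q}" "j \<in> {..<q}"
    then have "(i, 0) \<in> (edges {..<q} b)\<^sup>*" "(0, j) \<in> (edges {..<q} b)\<^sup>*"
      using root symD[OF sym_rtrancl[OF sym]] by auto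
    then show "(i, j) \<in> (edges {..<q} b)\<^sup>*" by (rule rtrancl_trans)
  qed
qed

section \<open>Labels\<close>

text \<open>Dickson polynomials of the second kind with the index shifted by one: the divided
  differences of powers, expressed through trace and norm.\<close>

fun trace_poly :: "complex \<Rightarrow> nat \<Rightarrow> complex poly" where
  "trace_poly n 0 = 0"
| "trace_poly n (Suc 0) = 1"
| "trace_poly n (Suc (Suc k)) = pCons 0 (trace_poly n (Suc k)) - smult n (trace_poly n k)"

lemma poly_trace_poly:
  "poly (trace_poly (x * y) k) (x + y) * (x - y) = x ^ k - y ^ k"
proof (induction "x * y" k rule: trace_poly.induct)
  case (3 k)
  have "poly (trace_poly (x * y) (Suc (Suc k))) (x + y) * (x - y)
      = (x + y) * (poly (trace_poly (x * y) (Suc k)) (x + y) * (x - y))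
        - (x * y) * (poly (trace_poly (x * y) k) (x + y) * (x - y))"
    by (simp add: algebra_simps)
  also have "\<dots> = x ^ Suc (Suc k) - y ^ Suc (Suc k)"
    unfolding 3 by (simp add: algebra_simps)
  finally show ?case .
qed simp_all

lemma trace_poly_Ints: "n \<in> \<int> \<Longrightarrow> coeff (trace_poly n k) i \<in> \<int>"
  by (induction n k arbitrary: i rule: trace_poly.induct)
    (auto simp: coeff_pCons coeff_1 split: nat.split)

lemma degree_trace_poly: "degree (trace_poly n (Suc k)) \<le> k \<and> coeff (trace_poly n (Suc k)) k = 1"
proof (induction k rule: less_induct)
  case (less k)
  show ?case
  proof (cases k)
    case (Suc l)
    have 1: "degree (trace_poly n (Suc l)) \<le> l" "coeff (trace_poly n (Suc l)) l = 1"
      using less[of l] Suc by auto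
    have 2: "degree (trace_poly n l) \<le> l \<and> coeff (trace_poly n l) (Suc l) = 0"
    proof (cases l)
      case (Suc j)
      then have "degree (trace_poly n l) \<le> j" using less[of j] \<open>k = Suc l\<close> by auto
      then show ?thesis using Suc by (auto intro: coeff_eq_0)
    qed simp
    have "degree (pCons 0 (trace_poly n (Suc l))) \<le> Suc l"
      using degree_pCons_le[of 0 "trace_poly n (Suc l)"] 1 by simp
    moreover have "degree (smult n (trace_poly n l)) \<le> Suc l"
      using degree_smult_le[of n "trace_poly n l"] 2 by simp
    ultimately have "degree (trace_poly n (Suc (Suc l))) \<le> Suc l"
      by (simp add: degree_diff_le)
    then show ?thesis using 1 2 Suc by simp
  qed simp
qed

text \<open>
  If \<open>p\<close> is a monic integral polynomial vanishing at \<open>x\<close> and \<open>y = cnj x\<close>, then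
  \<open>(p x - p y) / (x - y)\<close> is a monic integral polynomial in \<open>x + y\<close>.
\<close>

lemma algebraic_int_trace:
  assumes x: "algebraic_int x" and n: "x * cnj x \<in> \<int>"
  shows "algebraic_int (x + cnj x)"
proof (cases "x = cnj x")
  case True
  obtain p where p: "lead_coeff p = 1" "\<forall>i. coeff p i \<in> \<int>" "poly p x = 0"
    using x by (auto elim: algebraic_int.cases)
  define m where "m = degree p"
  \<comment> \<open>The quotient by \<open>x - y\<close> degenerates here. Instead \<open>q\<close>
    is \<open>2 ^ m * p (X / 2)\<close>, monic and integral with root \<open>2 * x\<close>.\<close>
  define q where "q = (\<Sum>i\<le>m. monom (coeff p i * 2 ^ (m - i)) i)"
  have cq: "coeff q i = (if i \<le> m then coeff p i * 2 ^ (m - i) else 0)" for i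
    unfolding q_def coeff_sum coeff_monom by (simp add: sum.delta)
  have "degree q \<le> m" by (rule degree_le) (simp add: cq)
  moreover have "coeff q m = 1" using p by (simp add: cq m_def)
  ultimately have "lead_coeff q = 1"
    by (metis le_antisym le_degree zero_neq_one)
  moreover have "\<forall>i. coeff q i \<in> \<int>" using p(2) by (auto simp: cq)
  moreover have "poly q (x + cnj x) = 0"
  proof -
    have "poly q (x + cnj x) = (\<Sum>i\<le>m. coeff p i * 2 ^ (m - i) * (2 * x) ^ i)"
      unfolding q_def True[symmetric] by (simp add: poly_sum poly_monom)
    also have "\<dots> = (\<Sum>i\<le>m. 2 ^ m * (coeff p i * x ^ i))"
    proof (intro sum.cong refl)
      fix i assume "i \<in> {..m}"
      then have "(2::complex) ^ m = 2 ^ (m - i) * 2 ^ i" by (simp flip: power_add)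
      then show "coeff p i * 2 ^ (m - i) * (2 * x) ^ i = 2 ^ m * (coeff p i * x ^ i)"
        by (simp add: power_mult_distrib)
    qed
    also have "\<dots> = 2 ^ m * poly p x" by (simp add: poly_altdef m_def sum_distrib_left)
    finally show ?thesis using p by simp
  qed
  ultimately show ?thesis by (intro algebraic_int.intros)
next
  case False
  obtain p where p: "lead_coeff p = 1" "\<forall>i. coeff p i \<in> \<int>" "poly p x = 0"
    using x by (auto elim: algebraic_int.cases)
  obtain m where m: "degree p = Suc m"
  proof (cases "degree p")
    case 0
    then obtain c where "p = [:c:]" by (rule degree_eq_zeroE)
    then show ?thesis using p by simp
  qed
  let ?U = "trace_poly (x * cnj x)"
  define q where "q = (\<Sum>k\<le>Suc m. smult (coeff p k) (?U k))"
  have high: "coeff (?U k) i = 0" if "k \<le> i" for k i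
  proof (cases k)
    case (Suc j)
    then have "degree (?U k) < i" using degree_trace_poly[of "x * cnj x" j] that by simp
    then show ?thesis by (rule coeff_eq_0)
  qed simp
  have cq: "coeff q i = (\<Sum>k\<le>Suc m. coeff p k * coeff (?U k) i)" for i
    unfolding q_def coeff_sum by simp
  have "degree q \<le> m"
    by (rule degree_le) (simp add: cq high)
  moreover have "coeff q m = 1"
    using p(1) m degree_trace_poly[of "x * cnj x" m] by (simp add: cq high)
  ultimately have "lead_coeff q = 1"
    by (metis le_antisym le_degree zero_neq_one)
  moreover have "\<forall>i. coeff q i \<in> \<int>"
    unfolding cq using p(2) trace_poly_Ints[OF n] by (auto intro!: Ints_sum Ints_mult)
  moreover have "poly q (x + cnj x) = 0"
  proof -
    have root: "(\<Sum>k\<le>Suc m. coeff p k * x ^ k) = 0" using p(3) m by (simp add: poly_altdef)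
    have cnj_coeff: "cnj (coeff p k) = coeff p k" for k
      using p(2) by (auto elim!: Ints_cases dest!: spec[of _ k])
    have "(\<Sum>k\<le>Suc m. coeff p k * cnj x ^ k) = cnj (\<Sum>k\<le>Suc m. coeff p k * x ^ k)"
      unfolding cnj_sum by (simp only: complex_cnj_mult complex_cnj_power cnj_coeff)
    then have root': "(\<Sum>k\<le>Suc m. coeff p k * cnj x ^ k) = 0" unfolding root by simp
    have "poly q (x + cnj x) * (x - cnj x)
        = (\<Sum>k\<le>Suc m. coeff p k * (poly (?U k) (x + cnj x) * (x - cnj x)))"
      unfolding q_def poly_sum poly_smult sum_distrib_right by (simp only: mult.assoc)
    also have "\<dots> = (\<Sum>k\<le>Suc m. coeff p k * x ^ k) - (\<Sum>k\<le>Suc m. coeff p k * cnj x ^ k)"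
      unfolding poly_trace_poly sum_subtractf[symmetric] by (simp only: right_diff_distrib)
    finally have "poly q (x + cnj x) * (x - cnj x) = 0" unfolding root root' by simp
    then show ?thesis using False by simp
  qed
  ultimately show ?thesis by (intro algebraic_int.intros)
qed

section \<open>Finiteness of the label set\<close>

lemma Re_quadratic_field:
  assumes "d < 0" "x \<in> quadratic_field d"
  shows "complex_of_real (Re x) \<in> \<rat>"
proof -
  obtain a b where x: "x = of_rat a + of_rat b * csqrt (of_int d)"
    using assms(2) by (auto simp: quadratic_field_def)
  have "csqrt (of_int d) = \<i> * sqrt \<bar>of_int d\<bar>"
    using csqrt_of_real_nonpos[of "of_int d"] assms(1) by simp
  moreover have re: "of_rat r = complex_of_real (of_rat r)" for r
    by (cases r) (simp add: of_rat_rat)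
  ultimately have "Re x = of_rat a" unfolding x re by simp
  then show ?thesis by (simp flip: re)
qed

text \<open>The trace \<open>x + cnj x\<close> is rational and an algebraic integer, hence an
  integer.\<close>

lemma norm_level_D:
  assumes "d < 0" "x \<in> norm_level d n"
  shows "(cmod x)\<^sup>2 = real n" and "2 * Re x \<in> \<int>"
proof -
  have x: "x \<in> quadratic_field d" "algebraic_int x" "x * cnj x = of_nat n"
    using assms(2) by (auto simp: norm_level_def ring_of_integers_def)
  have "complex_of_real ((cmod x)\<^sup>2) = complex_of_real (real n)"
    unfolding complex_norm_square x by simp
  then show "(cmod x)\<^sup>2 = real n" by (simp only: of_real_eq_iff)
  have sum: "x + cnj x = 2 * complex_of_real (Re x)" by (simp add: complex_add_cnj)
  have "algebraic_int (x + cnj x)" using x by (intro algebraic_int_trace) simp_all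
  moreover have "x + cnj x \<in> \<rat>"
    unfolding sum using Re_quadratic_field[OF assms(1) x(1)] by (intro Rats_mult) simp_all
  ultimately have "x + cnj x \<in> \<int>" by (rule rational_algebraic_int_is_int)
  then obtain k where "x + cnj x = of_int k" by (auto elim: Ints_cases)
  then have "2 * Re x = of_int k" unfolding sum by (simp add: complex_eq_iff)
  then show "2 * Re x \<in> \<int>" by simp
qed

text \<open>The integer \<open>2 * Re x\<close> is bounded in terms of \<open>n\<close>, and
  together with the norm it fixes \<open>x\<close> up to the sign of the imaginary part.\<close>

lemma finite_norm_level:
  assumes d: "d < 0"
  shows "finite (norm_level d n)"
proof (rule finite_subset)
  let ?g = "\<lambda>(k :: int, s :: real). Complex (of_int k / 2) (s * sqrt (real n - (of_int k / 2)\<^sup>2))"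
  let ?K = "{- int (2 * n + 2)..int (2 * n + 2)} \<times> {1, - 1}"
  show "finite (?g ` ?K)" by simp
  show "norm_level d n \<subseteq> ?g ` ?K"
  proof
    fix x assume x: "x \<in> norm_level d n"
    obtain k where k: "2 * Re x = of_int k" using norm_level_D(2)[OF d x] by (auto elim: Ints_cases)
    then have re: "Re x = of_int k / 2" by simp
    have sq: "(Re x)\<^sup>2 + (Im x)\<^sup>2 = real n" using norm_level_D(1)[OF d x] by (simp add: cmod_power2)
    have "(Re x)\<^sup>2 \<le> (real n + 1)\<^sup>2"
    proof -
      have "(Re x)\<^sup>2 \<le> real n" using sq by (smt (verit) zero_le_power2)
      also have "\<dots> \<le> (real n + 1)\<^sup>2" by (simp add: power2_eq_square algebra_simps)
      finally show ?thesis .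
    qed
    then have "\<bar>Re x\<bar> \<le> real n + 1" by (simp add: abs_le_square_iff[symmetric])
    then have "\<bar>real_of_int k\<bar> \<le> real (2 * n + 2)" using k by simp
    then have kK: "k \<in> {- int (2 * n + 2)..int (2 * n + 2)}" by (simp add: abs_le_iff)
    have "Im x = (if Im x < 0 then - 1 else 1) * sqrt (real n - (of_int k / 2)\<^sup>2)"
    proof -
      have "real n - (of_int k / 2)\<^sup>2 = (Im x)\<^sup>2" using sq re by simp
      then show ?thesis by simp
    qed
    then have "x = ?g (k, if Im x < 0 then - 1 else 1)"
      by (simp add: complex_eq_iff re)
    moreover have "(k, if Im x < 0 then - 1 else 1 :: real) \<in> ?K" using kK by simp
    ultimately show "x \<in> ?g ` ?K" by (rule image_eqI)
  qed
qed

lemma finite_label_set: "d < 0 \<Longrightarrow> finite (label_set d)"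
  unfolding label_set_def by (simp add: finite_norm_level)

lemma label_set_weight: "d < 0 \<Longrightarrow> x \<in> label_set d \<Longrightarrow> x = 0 \<or> (cmod x)\<^sup>2 \<in> {1, 2, 3, 4}"
  unfolding label_set_def using norm_level_D(1)[of d x] by force

lemma units_label_set: "0 \<in> label_set d" "1 \<in> label_set d" "- 1 \<in> label_set d"
proof -
  have "of_int k \<in> ring_of_integers d" for k
  proof -
    have "of_int k = of_rat (of_int k) + of_rat 0 * csqrt (of_int d)" by simp
    then have "of_int k \<in> quadratic_field d" unfolding quadratic_field_def by blast
    then show ?thesis by (simp add: ring_of_integers_def int_imp_algebraic_int)
  qed
  from this[of 1] this[of "-1"] show "1 \<in> label_set d" "- 1 \<in> label_set d"
    by (auto simp: label_set_def norm_level_def)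
qed (simp add: label_set_def)

lemma mat_adjoint_index:
  fixes A :: "complex mat"
  assumes "i < dim_col A" "j < dim_row A"
  shows "mat_adjoint A $$ (i, j) = cnj (A $$ (j, i))"
  using assms by (simp add: mat_adjoint_def mat_of_rows_def)

lemma hermitian_mat_iff:
  "hermitian_mat A \<longleftrightarrow> square_mat A \<and> (\<forall>i<dim_row A. \<forall>j<dim_row A. A $$ (j, i) = cnj (A $$ (i, j)))"
proof (cases "square_mat A")
  case True
  then have d: "dim_col A = dim_row A" by simp
  have da: "dim_row (mat_adjoint A) = dim_row A" "dim_col (mat_adjoint A) = dim_row A"
    by (simp_all add: mat_adjoint_def d)
  have "mat_adjoint A = A \<longleftrightarrow> (\<forall>j<dim_row A. \<forall>i<dim_row A. mat_adjoint A $$ (j, i) = A $$ (j, i))"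
    using da d by (metis eq_matI)
  also have "\<dots> \<longleftrightarrow> (\<forall>j<dim_row A. \<forall>i<dim_row A. cnj (A $$ (i, j)) = A $$ (j, i))"
    using d mat_adjoint_index[of _ A] by metis
  also have "\<dots> \<longleftrightarrow> (\<forall>i<dim_row A. \<forall>j<dim_row A. A $$ (j, i) = cnj (A $$ (i, j)))"
    by metis
  finally show ?thesis using True by (simp add: hermitian_mat_def)
qed (simp add: hermitian_mat_def)

section \<open>Cyclotomic, connected and contained matrices\<close>

lemma hermitian_matD:
  assumes "hermitian_mat A" "i < dim_row A" "j < dim_row A"
  shows "A $$ (j, i) = cnj (A $$ (i, j))"
  using assms unfolding hermitian_mat_iff by blast

section \<open>Eigenvalue bounds and semidefinite forms\<close>

lemma hermitian_adjoint:
  fixes a :: "'i \<Rightarrow> 'i \<Rightarrow> complex"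
  assumes "\<And>i j. i \<in> I \<Longrightarrow> j \<in> I \<Longrightarrow> a j i = cnj (a i j)"
  shows "(\<Sum>i\<in>I. cnj (\<Sum>j\<in>I. a i j * u j) * w i) = (\<Sum>j\<in>I. cnj (u j) * (\<Sum>i\<in>I. a j i * w i))"
proof -
  have "(\<Sum>i\<in>I. cnj (\<Sum>j\<in>I. a i j * u j) * w i) = (\<Sum>i\<in>I. \<Sum>j\<in>I. cnj (a i j * u j) * w i)"
    by (simp only: cnj_sum sum_distrib_right)
  also have "\<dots> = (\<Sum>j\<in>I. \<Sum>i\<in>I. cnj (a i j * u j) * w i)" by (rule sum.swap)
  also have "\<dots> = (\<Sum>j\<in>I. \<Sum>i\<in>I. cnj (u j) * (a j i * w i))"
  proof (intro sum.cong refl)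
    fix i j assume "j \<in> I" "i \<in> I"
    then have "a j i = cnj (a i j)" by (intro assms)
    then show "cnj (a i j * u j) * w i = cnj (u j) * (a j i * w i)"
      by (simp only: complex_cnj_mult mult_ac)
  qed
  finally show ?thesis by (simp only: sum_distrib_left)
qed

text \<open>\<open>conv\<close> is log-convexity, weakened by the inequality of arithmetic and
  geometric means to a linear condition for one fixed ratio \<open>r\<close>; it still propagates
  the growth of the first step.\<close>

lemma growth_of_iterates:
  fixes M :: "nat \<Rightarrow> real"
  assumes conv: "\<And>k. 2 * r * M (Suc k) \<le> r\<^sup>2 * M k + M (Suc (Suc k))"
    and first: "r * M 0 \<le> M 1" and r: "0 \<le> r"
  shows "r ^ k * M 0 \<le> M k"
proof -
  have step: "r * M k \<le> M (Suc k)" for k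
  proof (induction k)
    case (Suc k)
    have "r * (r * M k) \<le> r * M (Suc k)" using Suc r by (rule mult_left_mono)
    then show ?case using conv[of k] by (simp add: power2_eq_square)
  qed (use first in simp)
  show ?thesis
  proof (induction k)
    case (Suc k)
    have "r * (r ^ k * M 0) \<le> r * M k" using Suc r by (rule mult_left_mono)
    then show ?case using step[of k] by simp
  qed simp
qed

text \<open>
  If \<open>A x\<close> were longer than \<open>s x\<close> with \<open>s > 2\<close>, then by log-convexity the iterates of
  \<open>A / s\<close> would grow geometrically, although the spectral radius of \<open>A / s\<close> is less than 1.
\<close>

lemma cyclotomic_norm_le:
  assumes A: "A \<in> carrier_mat n n" and herm: "hermitian_mat A" and cyc: "cyclotomic A"
  shows "(\<Sum>i<n. (cmod (\<Sum>j<n. A $$ (i, j) * x j))\<^sup>2) \<le> 4 * (\<Sum>i<n. (cmod (x i))\<^sup>2)"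
proof (rule ccontr)
  assume contr: "\<not> ?thesis"
  define N where "N u = (\<Sum>i<n. (cmod (u i))\<^sup>2)" for u :: "nat \<Rightarrow> complex"
  define y where "y i = (\<Sum>j<n. A $$ (i, j) * x j)" for i
  have big: "4 * N x < N y" using contr by (simp add: N_def y_def)
  have N0: "0 \<le> N u" for u unfolding N_def by (simp add: sum_nonneg)
  have Nx: "0 < N x"
  proof (rule ccontr)
    assume "\<not> 0 < N x"
    then have "N x = 0" using N0[of x] by simp
    then have "\<forall>i<n. x i = 0" unfolding N_def by (simp add: sum_nonneg_eq_0_iff)
    then have "y i = 0" for i by (simp add: y_def)
    then show False using big N0[of x] by (simp add: N_def)
  qed
  then have n: "0 < n" by (auto simp: N_def intro: ccontr)
  \<comment> \<open>Room is kept on both sides: \<open>4 < q\<close> makes the spectral radius of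
    \<open>A / sqrt q\<close> less than 1, and \<open>q * N x < N y\<close> makes its first iterate
    longer than \<open>x\<close>.\<close>
  obtain q where q: "4 < q" "q * N x < N y"
  proof -
    have "4 < N y / N x" using big Nx by (simp add: field_simps)
    then obtain q where "4 < q" "q < N y / N x" using dense by blast
    then show ?thesis using that Nx by (simp add: field_simps)
  qed
  define s where "s = sqrt q"
  have s: "2 < s" "s\<^sup>2 = q"
    using q(1) real_sqrt_less_mono[of 4 q] by (simp_all add: s_def)
  define B where "B = of_real (1 / s) \<cdot>\<^sub>m A"
  have B: "B \<in> carrier_mat n n" using A by (simp add: B_def)
  have B_index: "B $$ (i, j) = of_real (1 / s) * A $$ (i, j)" if "i < n" "j < n" for i j
    using A that by (simp add: B_def)
  have "spectral_radius B < 1"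
  proof -
    obtain k where k: "eigenvalue B k" "spectral_radius B = cmod k"
      using spectral_radius_mem_max(1)[OF B n] by (auto simp: spectrum_def)
    then obtain v where v: "v \<in> carrier_vec n" "v \<noteq> 0\<^sub>v n" "B *\<^sub>v v = k \<cdot>\<^sub>v v"
      using B by (auto simp: eigenvalue_def eigenvector_def)
    have "A *\<^sub>v v = (of_real s * k) \<cdot>\<^sub>v v"
    proof (rule eq_vecI)
      fix i assume "i < dim_vec ((of_real s * k) \<cdot>\<^sub>v v)"
      then have i: "i < n" using v by simp
      have "(B *\<^sub>v v) $ i = k * v $ i" using v i by simp
      moreover have "(B *\<^sub>v v) $ i = of_real (1 / s) * (A *\<^sub>v v) $ i"
        using A v(1) i by (simp add: B_def scalar_prod_def sum_distrib_left mult.assoc)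
      ultimately have "of_real (1 / s) * (A *\<^sub>v v) $ i = k * v $ i" by simp
      then have "of_real s * (of_real (1 / s) * (A *\<^sub>v v) $ i) = of_real s * (k * v $ i)" by simp
      then show "(A *\<^sub>v v) $ i = ((of_real s * k) \<cdot>\<^sub>v v) $ i" using v i s by simp
    qed (use A v in simp)
    then have "eigenvalue A (of_real s * k)"
      using A v by (auto simp: eigenvalue_def eigenvector_def)
    then have "cmod (of_real s * k) \<le> 2" using cyc unfolding cyclotomic_def by fastforce
    then have "s * cmod k \<le> 2" using s by (simp add: norm_mult)
    moreover have "2 < s * 1" using s by simp
    ultimately have "s * cmod k < s * 1" by linarith
    then show ?thesis using k s by (simp only: mult_less_cancel_left_pos)
  qed
  \<comment> \<open>Through the Jordan normal form, a spectral radius below 1 bounds the entries of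
    all powers at once.\<close>
  then obtain c where "\<forall>k. norm_bound (B ^\<^sub>m k) c"
    using spectral_radius_jnf_norm_bound_less_1_upper_triangular[OF B] by blast
  then have c: "cmod ((B ^\<^sub>m k) $$ (i, j)) \<le> c" if "i < n" "j < n" for k i j
    using that B by (auto simp: norm_bound_def)
  define T where "T u i = (\<Sum>j<n. B $$ (i, j) * u j)" for u i
  have iter: "(T ^^ k) x i = (\<Sum>j<n. (B ^\<^sub>m k) $$ (i, j) * x j)" if "i < n" for k i x
    using that
  proof (induction k arbitrary: x)
    case 0
    have "(\<Sum>j<n. (B ^\<^sub>m 0) $$ (i, j) * x j) = (\<Sum>j<n. if j = i then x j else 0)"
      using 0 B by (intro sum.cong refl) auto
    then show ?case using 0 by simp
  next
    case (Suc k)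
    have "(T ^^ Suc k) x i = (T ^^ k) (T x) i" by (simp only: funpow_Suc_right o_apply)
    also have "\<dots> = (\<Sum>j<n. (B ^\<^sub>m k) $$ (i, j) * T x j)" by (rule Suc.IH[OF Suc.prems])
    also have "\<dots> = (\<Sum>j<n. \<Sum>l<n. (B ^\<^sub>m k) $$ (i, j) * B $$ (j, l) * x l)"
      by (simp add: T_def sum_distrib_left mult.assoc)
    also have "\<dots> = (\<Sum>l<n. \<Sum>j<n. (B ^\<^sub>m k) $$ (i, j) * B $$ (j, l) * x l)" by (rule sum.swap)
    also have "\<dots> = (\<Sum>l<n. (B ^\<^sub>m Suc k) $$ (i, l) * x l)"
    proof (intro sum.cong refl)
      fix l assume "l \<in> {..<n}"
      then have "(B ^\<^sub>m Suc k) $$ (i, l) = (\<Sum>j<n. (B ^\<^sub>m k) $$ (i, j) * B $$ (j, l))"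
        using Suc.prems B by (simp add: scalar_prod_def atLeast0LessThan)
      then show "(\<Sum>j<n. (B ^\<^sub>m k) $$ (i, j) * B $$ (j, l) * x l) = (B ^\<^sub>m Suc k) $$ (i, l) * x l"
        by (simp only: sum_distrib_right)
    qed
    finally show ?case .
  qed
  define M where "M k = N ((T ^^ k) x)" for k
  define K where "K = real n * (c * (\<Sum>j<n. cmod (x j)))\<^sup>2"
  have bounded: "M k \<le> K" for k
  proof -
    have "M k \<le> (\<Sum>i<n. (c * (\<Sum>j<n. cmod (x j)))\<^sup>2)"
      unfolding M_def N_def
    proof (rule sum_mono)
      fix i assume i: "i \<in> {..<n}"
      have "cmod ((T ^^ k) x i) \<le> (\<Sum>j<n. cmod ((B ^\<^sub>m k) $$ (i, j) * x j))"
        using i by (simp add: iter norm_sum)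
      also have "\<dots> \<le> (\<Sum>j<n. c * cmod (x j))"
        using c i by (intro sum_mono) (auto simp: norm_mult intro!: mult_right_mono)
      finally have "cmod ((T ^^ k) x i) \<le> c * (\<Sum>j<n. cmod (x j))" by (simp add: sum_distrib_left)
      then show "(cmod ((T ^^ k) x i))\<^sup>2 \<le> (c * (\<Sum>j<n. cmod (x j)))\<^sup>2" by (intro power_mono) auto
    qed
    then show ?thesis by (simp add: K_def)
  qed
  have hermB: "B $$ (j, i) = cnj (B $$ (i, j))" if "i \<in> {..<n}" "j \<in> {..<n}" for i j
  proof -
    have "A $$ (j, i) = cnj (A $$ (i, j))" by (rule hermitian_matD[OF herm]) (use A that in auto)
    then show ?thesis using B_index[of i j] B_index[of j i] that by simp
  qed
  define r where "r = M 1 / M 0"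
  have M0: "M 0 = N x" by (simp add: M_def)
  have M1: "q * M 1 = N y"
  proof -
    have "(cmod (T x i))\<^sup>2 * q = (cmod (y i))\<^sup>2" if "i < n" for i
    proof -
      have "T x i = of_real (1 / s) * y i"
        using that by (simp add: T_def y_def B_index sum_distrib_left mult.assoc)
      then show ?thesis using s q(1) by (simp add: norm_mult norm_divide power_mult_distrib power_divide)
    qed
    then show ?thesis unfolding M_def N_def by (simp add: sum_distrib_left mult.commute)
  qed
  have "q * M 0 < q * M 1" using q M1 M0 by simp
  then have "M 0 < M 1" using q by simp
  then have r: "1 < r" using Nx M0 by (simp add: r_def field_simps)
  have growth: "r ^ k * M 0 \<le> M k" for k
  proof (rule growth_of_iterates)
    show "r * M 0 \<le> M 1" using Nx M0 by (simp add: r_def)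
    show "0 \<le> r" using r by simp
    fix k
    let ?u = "(T ^^ k) x" and ?v = "(T ^^ Suc k) x" and ?w = "(T ^^ Suc (Suc k)) x"
    \<comment> \<open>By self-adjointness the squared length of an iterate is the inner product of
      the preceding and the following one; this is the source of log-convexity.\<close>
    have "(\<Sum>i<n. cnj (?v i) * ?v i) = (\<Sum>i<n. cnj (?u i) * ?w i)"
    proof -
      have v: "?v i = (\<Sum>j<n. B $$ (i, j) * ?u j)" and w: "?w i = (\<Sum>j<n. B $$ (i, j) * ?v j)" for i
        by (simp_all add: T_def)
      have "(\<Sum>i<n. cnj (?v i) * ?v i) = (\<Sum>i<n. cnj (\<Sum>j<n. B $$ (i, j) * ?u j) * ?v i)"
        by (simp only: v[symmetric])
      also have "\<dots> = (\<Sum>j<n. cnj (?u j) * (\<Sum>i<n. B $$ (j, i) * ?v i))"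
        by (rule hermitian_adjoint) (rule hermB)
      finally show ?thesis by (simp only: w[symmetric])
    qed
    moreover have "cnj z * z = of_real ((cmod z)\<^sup>2)" for z
      by (simp only: complex_norm_square mult.commute)
    ultimately have vv: "of_real (M (Suc k)) = (\<Sum>i<n. cnj (?u i) * ?w i)"
      by (simp add: M_def N_def del: funpow.simps)
    have "2 * r * Re (cnj u * w) \<le> r\<^sup>2 * (cmod u)\<^sup>2 + (cmod w)\<^sup>2" for u w
    proof -
      have "0 \<le> (r * Re u - Re w)\<^sup>2 + (r * Im u - Im w)\<^sup>2" by simp
      then show ?thesis unfolding cmod_power2 by (simp add: power2_eq_square algebra_simps)
    qed
    then have "(\<Sum>i<n. 2 * r * Re (cnj (?u i) * ?w i)) \<le> (\<Sum>i<n. r\<^sup>2 * (cmod (?u i))\<^sup>2 + (cmod (?w i))\<^sup>2)"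
      by (intro sum_mono) blast
    moreover have "M (Suc k) = (\<Sum>i<n. Re (cnj (?u i) * ?w i))"
      using arg_cong[OF vv, of Re] by (simp only: Re_complex_of_real Re_sum)
    ultimately show "2 * r * M (Suc k) \<le> r\<^sup>2 * M k + M (Suc (Suc k))"
      unfolding M_def N_def by (simp only: sum.distrib sum_distrib_left)
  qed
  obtain k where "K / M 0 < r ^ k" using real_arch_pow[OF r] by blast
  then have "K < r ^ k * M 0" using Nx M0 by (simp add: field_simps)
  then show False using growth[of k] bounded[of k] by simp
qed

lemma hform_shifted:
  assumes "finite I"
  shows "hform I (shifted e a) x
    = 2 * (\<Sum>i\<in>I. of_real ((cmod (x i))\<^sup>2)) + of_real e * (\<Sum>i\<in>I. cnj (x i) * (\<Sum>j\<in>I. a i j * x j))"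
proof -
  have "hform I (shifted e a) x
      = (\<Sum>i\<in>I. \<Sum>j\<in>I. (if i = j then 2 * (cnj (x j) * x j) else 0) + of_real e * (cnj (x i) * (a i j * x j)))"
    unfolding hform_def by (intro sum.cong refl) (simp add: shifted_def algebra_simps)
  also have "\<dots> = (\<Sum>i\<in>I. 2 * (cnj (x i) * x i)) + of_real e * (\<Sum>i\<in>I. \<Sum>j\<in>I. cnj (x i) * (a i j * x j))"
    using assms by (simp add: sum.distrib sum_distrib_left)
  also have "(\<Sum>i\<in>I. 2 * (cnj (x i) * x i)) = 2 * (\<Sum>i\<in>I. of_real ((cmod (x i))\<^sup>2))"
    unfolding sum_distrib_left by (intro sum.cong refl) (simp only: complex_norm_square mult.commute)
  finally show ?thesis by (simp only: sum_distrib_left)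
qed

text \<open>The squared length of \<open>2 * x + e * A x\<close> is at most four times the form at
  \<open>x\<close>, because \<open>A x\<close> is at most twice as long as \<open>x\<close>.\<close>

lemma psd_of_cyclotomic:
  assumes A: "A \<in> carrier_mat n n" and herm: "hermitian_mat A" and cyc: "cyclotomic A"
    and e: "e \<in> {1, -1}"
  shows "psd {..<n} (shifted e (\<lambda>i j. A $$ (i, j)))"
  unfolding psd_def
proof (intro conjI ballI allI)
  let ?a = "\<lambda>i j. A $$ (i, j)"
  show "shifted e ?a j i = cnj (shifted e ?a i j)" if "i \<in> {..<n}" "j \<in> {..<n}" for i j
  proof -
    have "A $$ (j, i) = cnj (A $$ (i, j))" by (rule hermitian_matD[OF herm]) (use A that in auto)
    then show ?thesis by (simp add: shifted_def)
  qed
  fix x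
  define y where "y i = (\<Sum>j<n. A $$ (i, j) * x j)" for i
  define N where "N u = (\<Sum>i<n. (cmod (u i))\<^sup>2)" for u :: "nat \<Rightarrow> complex"
  have le: "N y \<le> 4 * N x" unfolding N_def y_def by (rule cyclotomic_norm_le[OF A herm cyc])
  have "0 \<le> 4 * (cmod u)\<^sup>2 + 4 * e * Re (cnj u * w) + (cmod w)\<^sup>2" for u w
  proof -
    have "e * e = 1" using e by auto
    moreover have "0 \<le> (2 * Re u + e * Re w)\<^sup>2 + (2 * Im u + e * Im w)\<^sup>2" by simp
    moreover have "(2 * Re u + e * Re w)\<^sup>2 + (2 * Im u + e * Im w)\<^sup>2
        = 4 * (cmod u)\<^sup>2 + 4 * e * Re (cnj u * w) + (e * e) * (cmod w)\<^sup>2"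
      unfolding cmod_power2 by (simp add: power2_eq_square algebra_simps)
    ultimately show ?thesis by simp
  qed
  then have "0 \<le> (\<Sum>i<n. 4 * (cmod (x i))\<^sup>2 + 4 * e * Re (cnj (x i) * y i) + (cmod (y i))\<^sup>2)"
    by (intro sum_nonneg) blast
  also have "\<dots> = 4 * N x + 4 * e * (\<Sum>i<n. Re (cnj (x i) * y i)) + N y"
    by (simp only: sum.distrib sum_distrib_left N_def)
  finally have "0 \<le> 2 * N x + e * (\<Sum>i<n. Re (cnj (x i) * y i))" using le by simp
  also have "\<dots> = Re (hform {..<n} (shifted e ?a) x)"
    unfolding hform_shifted[OF finite_lessThan] by (simp add: N_def y_def[symmetric] Re_sum)
  finally show "0 \<le> Re (hform {..<n} (shifted e ?a) x)" .
qed

text \<open>At an eigenvector for \<open>k\<close> the forms take the value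
  \<open>2 + e * Re k\<close> times its squared length.\<close>

lemma cyclotomic_of_psd:
  assumes A: "A \<in> carrier_mat n n" and herm: "hermitian_mat A"
    and psd: "\<And>e. e \<in> {1, -1} \<Longrightarrow> psd {..<n} (shifted e (\<lambda>i j. A $$ (i, j)))"
  shows "cyclotomic A"
  unfolding cyclotomic_def
proof (intro allI impI)
  fix k assume "eigenvalue A k"
  then obtain v where v: "v \<in> carrier_vec n" "v \<noteq> 0\<^sub>v n" "A *\<^sub>v v = k \<cdot>\<^sub>v v"
    using A by (auto simp: eigenvalue_def eigenvector_def)
  define x where "x i = v $ i" for i
  define N where "N = (\<Sum>i<n. (cmod (x i))\<^sup>2)"
  have Ax: "(\<Sum>j<n. A $$ (i, j) * x j) = k * x i" if "i < n" for i
  proof -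
    have "(A *\<^sub>v v) $ i = (\<Sum>j<n. A $$ (i, j) * x j)"
      using A v(1) that by (simp add: scalar_prod_def atLeast0LessThan x_def)
    then show ?thesis using v that by (simp add: x_def)
  qed
  have cc: "cnj z * z = of_real ((cmod z)\<^sup>2)" for z by (simp only: complex_norm_square mult.commute)
  have S: "(\<Sum>i<n. cnj (x i) * (\<Sum>j<n. A $$ (i, j) * x j)) = k * of_real N"
  proof -
    have "(\<Sum>i<n. cnj (x i) * (\<Sum>j<n. A $$ (i, j) * x j)) = (\<Sum>i<n. k * (cnj (x i) * x i))"
      by (intro sum.cong refl) (simp add: Ax)
    then show ?thesis unfolding cc by (simp add: N_def sum_distrib_left)
  qed
  have S': "(\<Sum>i<n. cnj (\<Sum>j<n. A $$ (i, j) * x j) * x i) = cnj k * of_real N"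
  proof -
    have "(\<Sum>i<n. cnj (\<Sum>j<n. A $$ (i, j) * x j) * x i) = (\<Sum>i<n. cnj k * (cnj (x i) * x i))"
      by (intro sum.cong refl) (simp add: Ax)
    then show ?thesis unfolding cc by (simp add: N_def sum_distrib_left)
  qed
  have N: "0 < N"
  proof -
    obtain i where "i < n" "v $ i \<noteq> 0"
      using v by (metis carrier_vecD eq_vecI index_zero_vec)
    then have "0 < (cmod (x i))\<^sup>2" "i \<in> {..<n}" by (simp_all add: x_def)
    then show ?thesis unfolding N_def by (intro sum_pos2[of _ i]) auto
  qed
  have "(\<Sum>i<n. cnj (\<Sum>j<n. A $$ (i, j) * x j) * x i) = (\<Sum>j<n. cnj (x j) * (\<Sum>i<n. A $$ (j, i) * x i))"
    by (rule hermitian_adjoint, rule hermitian_matD[OF herm]) (use A in auto)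
  then have "cnj k * of_real N = k * of_real N" unfolding S S' .
  then have real: "cnj k = k" using N by simp
  have bound: "0 \<le> 2 + e * Re k" if e: "e \<in> {1, -1}" for e
  proof -
    have "0 \<le> Re (hform {..<n} (shifted e (\<lambda>i j. A $$ (i, j))) x)"
      by (rule psd_nonneg[OF psd[OF e]])
    also have "\<dots> = N * (2 + e * Re k)"
      unfolding hform_shifted[OF finite_lessThan] S by (simp add: N_def algebra_simps Re_sum)
    finally show ?thesis using N by (simp add: zero_le_mult_iff)
  qed
  have "k = of_real (Re k)" using real by (simp add: complex_eq_iff)
  moreover have "Re k \<in> {-2..2}" using bound[of 1] bound[of "-1"] by simp
  ultimately show "k \<in> complex_of_real ` {-2..2}" by (rule image_eqI)
qed

section \<open>Connectedness and block diagonal form\<close>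

lemma diag_block_mat_Cons_zero:
  assumes "\<forall>B\<in>set (B # Bs). square_mat B" "i < dim_row B" "dim_row B \<le> j"
    "j < dim_row (diag_block_mat (B # Bs))"
  shows "diag_block_mat (B # Bs) $$ (i, j) = 0"
proof -
  have sq: "square_mat (diag_block_mat Bs)" by (rule diag_block_mat_square) (use assms(1) in simp)
  have "dim_col B = dim_row B" using assms(1) by simp
  then show ?thesis using assms sq by (simp add: Let_def)
qed

lemma connected_mat_of_connected_on:
  assumes A: "A \<in> carrier_mat n n" and conn: "connected_on {..<n} (\<lambda>i j. A $$ (i, j))"
  shows "connected_mat A"
  unfolding connected_mat_def
proof
  assume "\<exists>Bs. length Bs > 1 \<and> (\<forall>B \<in> set Bs. square_mat B \<and> dim_row B \<ge> 1) \<and>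
      permutation_similar A (diag_block_mat Bs)"
  then obtain Bs' where Bs': "length Bs' > 1" "\<forall>B\<in>set Bs'. square_mat B \<and> dim_row B \<ge> 1"
    "permutation_similar A (diag_block_mat Bs')" by blast
  obtain B1 B2 Bs where "Bs' = B1 # B2 # Bs"
    using Bs'(1) by (cases Bs'; cases "tl Bs'") auto
  then have sq: "\<forall>B\<in>set (B1 # B2 # Bs). square_mat B \<and> dim_row B \<ge> 1"
    and sim: "permutation_similar A (diag_block_mat (B1 # B2 # Bs))"
    using Bs' by simp_all
  define k where "k = dim_row B1"
  let ?D = "diag_block_mat (B1 # B2 # Bs)"
  obtain p where p: "p permutes {..<n}" and D: "?D = mat n n (\<lambda>(i, j). A $$ (p i, p j))"
    using sim A by (auto simp: permutation_similar_def)
  have k: "1 \<le> k" using sq by (simp add: k_def)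
  have "dim_row ?D = k + dim_row B2 + sum_list (map dim_row Bs)"
    by (simp only: dim_diag_block_mat k_def list.map sum_list.Cons add.assoc)
  moreover have "dim_row ?D = n" unfolding D by simp
  ultimately have kn: "k < n" using sq by auto
  have zero: "A $$ (p i, p j) = 0" if "i < k" "k \<le> j" "j < n" for i j
  proof -
    have "?D $$ (i, j) = 0"
      by (rule diag_block_mat_Cons_zero) (use sq that \<open>dim_row ?D = n\<close> k_def in auto)
    then show ?thesis unfolding D using that by simp
  qed
  \<comment> \<open>The vertices of the first block are closed under adjacency, but
    \<open>p k\<close> lies outside.\<close>
  let ?C = "p ` {..<k}"
  have closed: "y \<in> ?C" if "x \<in> ?C" "(x, y) \<in> edges {..<n} (\<lambda>i j. A $$ (i, j))" for x y
  proof -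
    from that(1) obtain i where i: "i < k" "x = p i" by auto
    have "y < n" "A $$ (x, y) \<noteq> 0" using that by (auto simp: edges_def)
    then obtain j where j: "j < n" "y = p j" using permutes_image[OF p] by (auto simp: set_eq_iff image_iff)
    then have "j < k" using zero[of i j] i \<open>A $$ (x, y) \<noteq> 0\<close> by force
    then show ?thesis using j by simp
  qed
  have pn: "p i < n" if "i < n" for i using permutes_in_image[OF p, of i] that by simp
  have "(p 0, p k) \<in> (edges {..<n} (\<lambda>i j. A $$ (i, j)))\<^sup>*"
    using conn pn k kn by (auto simp: connected_on_def)
  then have "p k \<in> ?C"
    by (induction rule: rtrancl_induct) (use k closed in auto)
  then show False using permutes_inj[OF p] by (auto simp: inj_eq)
qed

lemma permutation_onto:
  fixes n :: nat
  assumes "C \<subseteq> {..<n}"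
  obtains p where "p permutes {..<n}" "p ` {..<card C} = C"
proof -
  let ?k = "card C"
  have fin: "finite C" using assms finite_subset by blast
  have kn: "?k \<le> n" using card_mono[OF _ assms] by simp
  obtain f where f: "bij_betw f {..<?k} C"
    using finite_same_card_bij[of "{..<?k}" C] fin by auto
  obtain g where g: "bij_betw g {?k..<n} ({..<n} - C)"
    using finite_same_card_bij[of "{?k..<n}" "{..<n} - C"] assms by (auto simp: card_Diff_subset fin)
  define p where "p i = (if i < ?k then f i else if i < n then g i else i)" for i
  have pf: "bij_betw p {..<?k} C"
    using f by (subst bij_betw_cong[of _ _ f]) (auto simp: p_def)
  have pg: "bij_betw p {?k..<n} ({..<n} - C)"
    using g by (subst bij_betw_cong[of _ _ g]) (auto simp: p_def)
  have "bij_betw p ({..<?k} \<union> {?k..<n}) (C \<union> ({..<n} - C))"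
    by (rule bij_betw_combine[OF pf pg]) auto
  moreover have "{..<?k} \<union> {?k..<n} = {..<n}" using kn by auto
  moreover have "C \<union> ({..<n} - C) = {..<n}" using assms by auto
  ultimately have "bij_betw p {..<n} {..<n}" by simp
  then have "p permutes {..<n}" by (rule bij_imp_permutes) (use kn in \<open>auto simp: p_def\<close>)
  then show ?thesis using that pf by (auto simp: bij_betw_def)
qed

lemma connected_on_of_connected_mat:
  assumes A: "A \<in> carrier_mat n n" and herm: "hermitian_mat A" and conn: "connected_mat A"
  shows "connected_on {..<n} (\<lambda>i j. A $$ (i, j))"
proof (rule ccontr)
  let ?E = "edges {..<n} (\<lambda>i j. A $$ (i, j))"
  assume "\<not> connected_on {..<n} (\<lambda>i j. A $$ (i, j))"
  then obtain i0 j0 where ij0: "i0 < n" "j0 < n" "(i0, j0) \<notin> ?E\<^sup>*"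
    by (auto simp: connected_on_def)
  \<comment> \<open>The component of \<open>i0\<close>: a permutation that moves it to the front
    exhibits two diagonal blocks.\<close>
  define C where "C = {j. j < n \<and> (i0, j) \<in> ?E\<^sup>*}"
  define k where "k = card C"
  have C: "C \<subseteq> {..<n}" "i0 \<in> C" "j0 \<notin> C" using ij0 by (auto simp: C_def)
  have fin: "finite C" using C(1) finite_subset by blast
  have k0: "1 \<le> k" using C(2) fin by (auto simp: k_def Suc_le_eq card_gt_0_iff)
  have kn: "k < n"
    using psubset_card_mono[of "{..<n}" C] C ij0(2) by (auto simp: k_def)
  have cross: "A $$ (x, y) = 0 \<and> A $$ (y, x) = 0" if "x \<in> C" "y \<notin> C" "y < n" for x y
  proof -
    have xn: "x < n" using that C by auto
    have "A $$ (x, y) = 0"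
    proof (rule ccontr)
      assume "A $$ (x, y) \<noteq> 0"
      then have "(x, y) \<in> ?E" using xn that by (simp add: edges_def)
      then have "y \<in> C" using that by (auto simp: C_def intro: rtrancl_into_rtrancl)
      then show False using that by simp
    qed
    moreover have "A $$ (y, x) = cnj (A $$ (x, y))"
      by (rule hermitian_matD[OF herm]) (use A xn that in auto)
    ultimately show ?thesis by simp
  qed
  obtain p where p: "p permutes {..<n}" and pC: "p ` {..<k} = C"
    using permutation_onto[OF C(1)] unfolding k_def by blast
  have pn: "p i < n" if "i < n" for i using permutes_in_image[OF p, of i] that by simp
  have in_C: "p i \<in> C" if "i < k" for i using pC that by auto
  have not_C: "p i \<notin> C" if "k \<le> i" for i
    using permutes_inj[OF p] pC that by (auto simp: inj_eq simp flip: pC)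
  define B1 where "B1 = mat k k (\<lambda>(i, j). A $$ (p i, p j))"
  define B2 where "B2 = mat (n - k) (n - k) (\<lambda>(i, j). A $$ (p (i + k), p (j + k)))"
  have "diag_block_mat [B1, B2] = mat n n (\<lambda>(i, j). A $$ (p i, p j))"
  proof (rule eq_matI)
    fix i j assume "i < dim_row (mat n n (\<lambda>(i, j). A $$ (p i, p j)))"
      "j < dim_col (mat n n (\<lambda>(i, j). A $$ (p i, p j)))"
    then have ij: "i < n" "j < n" by simp_all
    show "diag_block_mat [B1, B2] $$ (i, j) = mat n n (\<lambda>(i, j). A $$ (p i, p j)) $$ (i, j)"
    proof (cases "i < k"; cases "j < k")
      assume "\<not> i < k" "\<not> j < k"
      moreover from this have "i - k < n - k" "j - k < n - k" using ij by auto
      ultimately show ?thesis using ij kn by (simp add: B1_def B2_def Let_def)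
    next
      assume "i < k" "\<not> j < k"
      then show ?thesis using ij kn cross[OF in_C[of i] not_C[of j]] pn
        by (simp add: B1_def B2_def Let_def)
    next
      assume "\<not> i < k" "j < k"
      then show ?thesis using ij kn cross[OF in_C[of j] not_C[of i]] pn
        by (simp add: B1_def B2_def Let_def)
    qed (use ij kn in \<open>simp_all add: B1_def B2_def Let_def\<close>)
  qed (use kn in \<open>simp_all add: B1_def B2_def Let_def\<close>)
  then have "permutation_similar A (diag_block_mat [B1, B2])"
    using A p by (auto simp: permutation_similar_def)
  moreover have "\<forall>B\<in>set [B1, B2]. square_mat B \<and> dim_row B \<ge> 1"
    using k0 kn by (auto simp: B1_def B2_def)
  ultimately show False using conn unfolding connected_mat_def
    by (metis One_nat_def length_Cons list.size(3) lessI)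
qed

section \<open>Containment as an embedding of index sets\<close>

lemma contained_inE:
  assumes "contained_in H G" and G: "square_mat G"
  obtains f where "inj_on f {..<dim_row H}" "f ` {..<dim_row H} \<subseteq> {..<dim_row G}"
    "\<And>i j. i < dim_row H \<Longrightarrow> j < dim_row H \<Longrightarrow> H $$ (i, j) = G $$ (f i, f j)"
proof -
  obtain I p where I: "I \<subseteq> {..<dim_row G}"
    and p: "p permutes {..<dim_row (submatrix G I I)}"
    and H: "H = mat (dim_row (submatrix G I I)) (dim_row (submatrix G I I))
        (\<lambda>(i, j). submatrix G I I $$ (p i, p j))"
    using assms(1) by (auto simp: contained_in_def permutation_similar_def)
  have set: "{i. i < dim_row G \<and> i \<in> I} = I" using I by auto
  have dims: "dim_row (submatrix G I I) = card I" by (simp add: dim_submatrix set)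
  have dH: "dim_row H = card I" by (simp add: H dims)
  have pr: "p i < card I" if "i < card I" for i
    using permutes_in_image[OF p, of i] that dims by simp
  define f where "f = pick I \<circ> p"
  show ?thesis
  proof (rule that[of f])
    have "inj_on (pick I) {..<card I}"
      by (rule inj_onI) (metis card_pick_le lessThan_iff)
    moreover have "inj_on p {..<card I}" using permutes_inj[OF p] by (rule inj_on_subset) simp
    moreover have "p ` {..<card I} \<subseteq> {..<card I}" using pr by auto
    ultimately show "inj_on f {..<dim_row H}"
      unfolding f_def dH by (meson comp_inj_on inj_on_subset)
    show "f ` {..<dim_row H} \<subseteq> {..<dim_row G}"
      using pick_in_set_le[of _ I] pr I unfolding dH f_def by force
    show "H $$ (i, j) = G $$ (f i, f j)" if "i < dim_row H" "j < dim_row H" for i j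
    proof -
      have "H $$ (i, j) = submatrix G I I $$ (p i, p j)" using that by (simp add: H)
      also have "\<dots> = G $$ (pick I (p i), pick I (p j))"
        using pr that G set by (intro submatrix_index) (simp_all add: dH)
      finally show ?thesis by (simp add: f_def)
    qed
  qed
qed

lemma contained_inI:
  assumes H: "square_mat H" and G: "square_mat G"
    and f: "inj_on f {..<dim_row H}" "f ` {..<dim_row H} \<subseteq> {..<dim_row G}"
    and eq: "\<And>i j. i < dim_row H \<Longrightarrow> j < dim_row H \<Longrightarrow> H $$ (i, j) = G $$ (f i, f j)"
  shows "contained_in H G"
proof -
  let ?m = "dim_row H"
  define I where "I = f ` {..<?m}"
  have card: "card I = ?m" using f(1) by (simp add: I_def card_image)
  have fin: "finite I" by (simp add: I_def)
  have set: "{i. i < dim_row G \<and> i \<in> I} = I" using f(2) by (auto simp: I_def)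
  \<comment> \<open>The rank of \<open>f i\<close> within \<open>I\<close> inverts
    \<open>pick\<close>; the identity beyond \<open>?m\<close> makes \<open>p\<close> a
    permutation.\<close>
  define p where "p i = (if i < ?m then card {a \<in> I. a < f i} else i)" for i
  have pick: "pick I (p i) = f i" if "i < ?m" for i
    using that pick_card_in_set[of "f i" I] by (simp add: p_def I_def)
  have range: "p i < ?m" if "i < ?m" for i
  proof -
    have "{a \<in> I. a < f i} \<subset> I" using that by (auto simp: I_def)
    then have "card {a \<in> I. a < f i} < card I" using fin by (rule psubset_card_mono[rotated])
    then show ?thesis using that by (simp add: p_def card)
  qed
  have "inj_on p {..<?m}"
    by (rule inj_onI) (metis f(1) inj_onD lessThan_iff pick)
  moreover have "p ` {..<?m} \<subseteq> {..<?m}" using range by auto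
  ultimately have "bij_betw p {..<?m} {..<?m}"
    using endo_inj_surj[of "{..<?m}" p] by (simp add: bij_betw_def)
  then have p: "p permutes {..<?m}" by (rule bij_imp_permutes) (simp add: p_def)
  have dims: "dim_row (submatrix G I I) = ?m" "dim_col (submatrix G I I) = ?m"
    using G by (simp_all add: dim_submatrix set card)
  have "H = mat ?m ?m (\<lambda>(i, j). submatrix G I I $$ (p i, p j))"
  proof (rule eq_matI)
    fix i j assume "i < dim_row (mat ?m ?m (\<lambda>(i, j). submatrix G I I $$ (p i, p j)))"
      "j < dim_col (mat ?m ?m (\<lambda>(i, j). submatrix G I I $$ (p i, p j)))"
    then have ij: "i < ?m" "j < ?m" by simp_all
    have "submatrix G I I $$ (p i, p j) = G $$ (pick I (p i), pick I (p j))"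
      using G range ij by (intro submatrix_index) (simp_all add: set card)
    then show "H $$ (i, j) = mat ?m ?m (\<lambda>(i, j). submatrix G I I $$ (p i, p j)) $$ (i, j)"
      using ij eq pick by simp
  qed (use H in simp_all)
  then have "permutation_similar (submatrix G I I) H"
    using p dims by (auto simp: permutation_similar_def)
  then show ?thesis using f(2) by (auto simp: contained_in_def I_def)
qed

section \<open>Maximal extensions\<close>

lemma connected_kernel_iff:
  "connected_kernel V a \<longleftrightarrow> cyclotomic_kernel V a \<and> connected_on V a"
  by (auto simp: connected_kernel_def connected_kernel_axioms_def connected_on_def)

lemma connected_kernel_of_graph:
  assumes d: "d < 0" and A: "connected_cyclotomic_graph d A"
  shows "connected_kernel {..<dim_row A} (\<lambda>i j. A $$ (i, j))"
proof -
  have herm: "hermitian_mat A" and cyc: "cyclotomic A" and conn: "connected_mat A"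
    and labels: "\<And>i. i < dim_row A \<Longrightarrow> A $$ (i, i) \<in> {0, 1, -1}"
      "\<And>i j. i < dim_row A \<Longrightarrow> j < dim_row A \<Longrightarrow> i \<noteq> j \<Longrightarrow> A $$ (i, j) \<in> label_set d"
    using A by (auto simp: connected_cyclotomic_graph_def charged_graph_def)
  have carrier: "A \<in> carrier_mat (dim_row A) (dim_row A)" using herm by (auto simp: hermitian_mat_def)
  have "cyclotomic_kernel {..<dim_row A} (\<lambda>i j. A $$ (i, j))"
  proof
    show "psd {..<dim_row A} (shifted e (\<lambda>i j. A $$ (i, j)))" if "e \<in> {1, -1}" for e
      by (rule psd_of_cyclotomic[OF carrier herm cyc that])
    show "A $$ (i, j) = 0 \<or> (cmod (A $$ (i, j)))\<^sup>2 \<in> {1, 2, 3, 4}"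
      if "i \<in> {..<dim_row A}" "j \<in> {..<dim_row A}" "i \<noteq> j" for i j
      using label_set_weight[OF d labels(2)] that by simp
  qed (use labels in auto)
  then show ?thesis
    using connected_on_of_connected_mat[OF carrier herm conn] by (simp add: connected_kernel_iff)
qed

lemma graph_of_connected_kernel:
  assumes carrier: "A \<in> carrier_mat n n" and n: "1 \<le> n"
    and ker: "connected_kernel {..<n} (\<lambda>i j. A $$ (i, j))"
    and labels: "\<And>i j. i < n \<Longrightarrow> j < n \<Longrightarrow> i \<noteq> j \<Longrightarrow> A $$ (i, j) \<in> label_set d"
  shows "connected_cyclotomic_graph d A"
proof -
  interpret connected_kernel "{..<n}" "\<lambda>i j. A $$ (i, j)" by fact
  have dims: "dim_row A = n" "dim_col A = n" using carrier by auto
  have hm: "hermitian_mat A"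
    unfolding hermitian_mat_iff
  proof (intro conjI allI impI)
    show "A $$ (j, i) = cnj (A $$ (i, j))" if "i < dim_row A" "j < dim_row A" for i j
      by (rule herm) (use that dims in auto)
  qed (use dims in simp)
  have "connected_mat A"
    by (rule connected_mat_of_connected_on[OF carrier]) (use ker in \<open>simp add: connected_kernel_iff\<close>)
  moreover have "cyclotomic A"
    by (rule cyclotomic_of_psd[OF carrier hm psd_shifted])
  ultimately show ?thesis
    using hm n labels charge dims by (auto simp: connected_cyclotomic_graph_def charged_graph_def)
qed

lemma contained_in_trans:
  assumes "square_mat A" "square_mat B" "square_mat C" "contained_in A B" "contained_in B C"
  shows "contained_in A C"
proof -
  obtain f where f: "inj_on f {..<dim_row A}" "f ` {..<dim_row A} \<subseteq> {..<dim_row B}"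
    "\<And>i j. i < dim_row A \<Longrightarrow> j < dim_row A \<Longrightarrow> A $$ (i, j) = B $$ (f i, f j)"
    using contained_inE[OF assms(4,2)] by metis
  obtain g where g: "inj_on g {..<dim_row B}" "g ` {..<dim_row B} \<subseteq> {..<dim_row C}"
    "\<And>i j. i < dim_row B \<Longrightarrow> j < dim_row B \<Longrightarrow> B $$ (i, j) = C $$ (g i, g j)"
    using contained_inE[OF assms(5,3)] by metis
  have fB: "f i < dim_row B" if "i < dim_row A" for i using f(2) that by auto
  have gC: "g i < dim_row C" if "i < dim_row B" for i using g(2) that by auto
  show ?thesis
  proof (rule contained_inI[where f = "g \<circ> f"])
    show "inj_on (g \<circ> f) {..<dim_row A}" by (rule comp_inj_on[OF f(1) inj_on_subset[OF g(1) f(2)]])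
    show "(g \<circ> f) ` {..<dim_row A} \<subseteq> {..<dim_row C}" using fB gC by auto
    show "A $$ (i, j) = C $$ ((g \<circ> f) i, (g \<circ> f) j)" if "i < dim_row A" "j < dim_row A" for i j
      using f(3)[OF that] g(3)[OF fB[OF that(1)] fB[OF that(2)]] by simp
  qed (use assms in auto)
qed

lemma graph_square: "connected_cyclotomic_graph d A \<Longrightarrow> square_mat A"
  by (simp add: connected_cyclotomic_graph_def charged_graph_def hermitian_mat_def)

lemma maximal_extension_mono:
  assumes A: "connected_cyclotomic_graph d A" and B: "connected_cyclotomic_graph d B"
    and AB: "contained_in A B" and max: "\<exists>G. maximal_graph d G \<and> contained_in B G"
  shows "\<exists>G. maximal_graph d G \<and> contained_in A G"
proof -
  obtain G where G: "maximal_graph d G" "contained_in B G" using max by blast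
  then have "connected_cyclotomic_graph d G" unfolding maximal_graph_def by blast
  then have "contained_in A G"
    using contained_in_trans[OF graph_square[OF A] graph_square[OF B] graph_square AB G(2)] by blast
  then show ?thesis using G(1) by blast
qed

section \<open>Unbounded extensions and their caps\<close>

definition unbounded_extensions :: "int \<Rightarrow> complex mat \<Rightarrow> bool" where
  "unbounded_extensions d A \<longleftrightarrow>
     (\<forall>N. \<exists>G. connected_cyclotomic_graph d G \<and> contained_in A G \<and> N < dim_row G)"

lemma unbounded_extensions_of_no_maximal:
  assumes A: "connected_cyclotomic_graph d A"
    and no_max: "\<not> (\<exists>G. maximal_graph d G \<and> contained_in A G)"
  shows "unbounded_extensions d A"
  unfolding unbounded_extensions_def
proof
  fix N
  show "\<exists>G. connected_cyclotomic_graph d G \<and> contained_in A G \<and> N < dim_row G"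
  proof (induction N)
    case 0
    have "contained_in A A"
      by (rule contained_inI[where f = id]) (use graph_square[OF A] in auto)
    moreover have "0 < dim_row A"
      using A by (simp add: connected_cyclotomic_graph_def charged_graph_def)
    ultimately show ?case using A by blast
  next
    case (Suc N)
    then obtain G where G: "connected_cyclotomic_graph d G" "contained_in A G" "N < dim_row G" by blast
    then obtain B where B: "connected_cyclotomic_graph d B" "dim_row G < dim_row B" "contained_in G B"
      using no_max unfolding maximal_graph_def by blast
    have "contained_in A B"
      by (rule contained_in_trans[OF graph_square[OF A] graph_square[OF G(1)] graph_square[OF B(1)] G(2) B(3)])
    then show ?case using B G by (intro exI[of _ B]) auto
  qed
qed

text \<open>The ten vertices between \<open>A\<close> and the tail are those excluded in \<open>path_centre\<close>.\<close>

definition tail_kernel :: "int \<Rightarrow> complex mat \<Rightarrow> nat \<Rightarrow> (nat \<Rightarrow> nat \<Rightarrow> complex) \<Rightarrow> bool" where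
  "tail_kernel d A W K \<longleftrightarrow> (let n = dim_row A; p = n + 10 in
      cyclotomic_kernel {..<p + W} K
      \<and> (\<forall>i<n. \<forall>j<n. K i j = A $$ (i, j))
      \<and> (\<forall>i<p + W. \<forall>j<p + W. i \<noteq> j \<longrightarrow> K i j \<in> label_set d)
      \<and> (\<forall>i. n \<le> i \<longrightarrow> i < p + W \<longrightarrow> (\<exists>j<i. K i j \<noteq> 0))
      \<and> (\<forall>i j. p \<le> j \<longrightarrow> j < p + W \<longrightarrow> i + 1 < j \<longrightarrow> K i j = 0)
      \<and> (\<forall>i<W. cmod (K (p + i - 1) (p + i)) = 1) \<and> (\<forall>i<W. K (p + i) (p + i) = 0))"

lemma long_tail:
  assumes d: "d < 0" and A: "connected_cyclotomic_graph d A" and unb: "unbounded_extensions d A"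
  shows "\<exists>K. tail_kernel d A W K"
proof -
  define n where "n = dim_row A"
  define p where "p = n + 10"
  have n: "0 < n" using A by (simp add: n_def connected_cyclotomic_graph_def charged_graph_def)
  \<comment> \<open>At most \<open>n * 5 ^ (W + 20)\<close> vertices have level up to
    \<open>W + 20\<close>, so this \<open>G\<close> has one beyond, and a shortest path to it is
    long enough for \<open>attach_props\<close>.\<close>
  obtain G where G: "connected_cyclotomic_graph d G" "contained_in A G" "n * 5 ^ (W + 20) < dim_row G"
    using unb unfolding unbounded_extensions_def by blast
  obtain f where f: "inj_on f {..<n}" "f ` {..<n} \<subseteq> {..<dim_row G}"
    "\<And>i j. i < n \<Longrightarrow> j < n \<Longrightarrow> A $$ (i, j) = G $$ (f i, f j)"
    using contained_inE[OF G(2) graph_square[OF G(1)]] unfolding n_def by metis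
  let ?g = "\<lambda>i j. G $$ (i, j)" and ?X = "f ` {..<n}"
  interpret G: connected_kernel "{..<dim_row G}" ?g by (rule connected_kernel_of_graph[OF d G(1)])
  have X: "?X \<subseteq> {..<dim_row G}" "?X \<noteq> {}" using f n by auto
  have "card ?X * 5 ^ (W + 20) < card {..<dim_row G}" using G(3) f(1) by (simp add: card_image)
  then obtain v where v: "v \<in> {..<dim_row G}" "W + 20 < G.level ?X v"
    by (rule G.exists_high_level[OF X])
  obtain s where s: "G.level_path ?X s (G.level ?X v)"
    using G.level_path_exists[OF X v(1)] by blast
  define h where "h = attach n f s"
  note props = G.attach_props[OF f(1,2) n s less_imp_le[OF v(2)], folded h_def]
  have h_inj: "inj_on h {..<p + W}" and h_sub: "h ` {..<p + W} \<subseteq> {..<dim_row G}"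
    unfolding p_def using props(1,2) by auto
  have "cyclotomic_kernel {..<p + W} (\<lambda>i j. G $$ (h i, h j))"
    by (rule G.pullback[OF _ h_inj h_sub]) simp
  moreover have "G $$ (h i, h j) = A $$ (i, j)" if "i < n" "j < n" for i j
    using f(3)[OF that] that by (simp add: h_def attach_def)
  moreover have "G $$ (h i, h j) \<in> label_set d" if "i < p + W" "j < p + W" "i \<noteq> j" for i j
  proof -
    have "h i < dim_row G" "h j < dim_row G" using h_sub that by auto
    moreover have "h i \<noteq> h j" using h_inj that by (auto simp: inj_on_def)
    ultimately show ?thesis
      using G(1) by (simp add: connected_cyclotomic_graph_def charged_graph_def)
  qed
  moreover have "G $$ (h i, h j) = 0" if "p \<le> j" "j < p + W" "i + 1 < j" for i j
    using props(3)[of j i] that by (simp add: p_def)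
  moreover have "cmod (G $$ (h (p + i - 1), h (p + i))) = 1" "G $$ (h (p + i), h (p + i)) = 0"
    if "i < W" for i
    using props(4,5)[OF that] by (simp_all only: p_def)
  moreover have "\<exists>j<i. G $$ (h i, h j) \<noteq> 0" if "n \<le> i" "i < p + W" for i
    using props(6)[of i] that by (simp add: p_def)
  ultimately show ?thesis
    unfolding tail_kernel_def Let_def n_def[symmetric] p_def[symmetric]
    by (intro exI[of _ "\<lambda>i j. G $$ (h i, h j)"] conjI allI impI) blast+
qed

text \<open>\<open>A\<close> stays the upper left block, so a cap already present in
  \<open>A\<close> survives, and the new cap, at indices from \<open>p \<ge> dim_row A\<close> on,
  is disjoint from it.\<close>

lemma add_cap:
  assumes d: "d < 0" and A: "connected_cyclotomic_graph d A" and unb: "unbounded_extensions d A"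
  obtains B p where "connected_cyclotomic_graph d B" "dim_row A \<le> p" "dim_row B = p + 2"
    "\<And>i j. i < dim_row A \<Longrightarrow> j < dim_row A \<Longrightarrow> B $$ (i, j) = A $$ (i, j)"
    "B $$ (p, p) = 1" "B $$ (Suc p, Suc p) = 1" "B $$ (p, Suc p) = 1"
proof -
  define n where "n = dim_row A"
  define p where "p = n + 10"
  have n: "0 < n" using A by (simp add: n_def connected_cyclotomic_graph_def charged_graph_def)
  have np: "n < p" by (simp add: n_def p_def)
  obtain K where "\<And>W. tail_kernel d A W (K W)"
    using long_tail[OF d A unb] by metis
  note T = this[unfolded tail_kernel_def Let_def, folded n_def, folded p_def]
  have K: "cyclotomic_kernel {..<p + W} (K W)" for W
    using T[of W] by blast
  have KA: "K W i j = A $$ (i, j)" if "i < n" "j < n" for W i j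
    using T[of W] that by blast
  have K_label: "K W i j \<in> label_set d" if "i < p + W" "j < p + W" "i \<noteq> j" for W i j
    using T[of W] that by blast
  have K_conn: "\<exists>j<i. K W i j \<noteq> 0" if "n \<le> i" "i < p + W" for W i
    using T[of W] that by blast
  have K_far: "K W i j = 0" if "p \<le> j" "j < p + W" "i + 1 < j" for W i j
    using T[of W] that by blast
  have K_edge: "cmod (K W (p + i - 1) (p + i)) = 1" and K_diag: "K W (p + i) (p + i) = 0"
    if "i < W" for W i
    using T[of W] that by blast+
  \<comment> \<open>\<open>restrict\<close> places the cut matrices in a finite space of extensional
    functions. There \<open>{0, 1, -1}\<close> is joined to the labels to cover the charges on the
    diagonal.\<close>
  define R where "R W = restrict (\<lambda>(i, j). K W i j) ({..<p} \<times> {..<p})" for W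
  have "R ` UNIV \<subseteq> ({..<p} \<times> {..<p}) \<rightarrow>\<^sub>E (label_set d \<union> {0, 1, -1})"
  proof -
    have labels: "K W i j \<in> label_set d \<union> {0, 1, -1}" if "i < p" "j < p" for W i j
      using K_label[of i W j] cyclotomic_kernel.charge[OF K[of W], of i] that by (cases "i = j") auto
    show ?thesis
      unfolding R_def
    proof (intro image_subsetI restrict_PiE_iff[THEN iffD2] ballI)
      fix W z assume "z \<in> {..<p} \<times> {..<p}"
      then obtain i j where "z = (i, j)" "i < p" "j < p" by auto
      then show "(case z of (i, j) \<Rightarrow> K W i j) \<in> label_set d \<union> {0, 1, -1}"
        using labels[of i j W] by simp
    qed
  qed
  then have "finite (range R)"
    by (rule finite_subset) (intro finite_PiE; simp add: finite_label_set[OF d])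
  then obtain W0 where "infinite {W \<in> UNIV. R W = R W0}"
    using pigeonhole_infinite[of UNIV R] by auto
  then have S: "infinite {W. R W = R W0}" by simp
  define a where "a = K W0"
  have same: "K W i j = a i j" if "R W = R W0" "i < p" "j < p" for W i j
    using fun_cong[OF that(1), of "(i, j)"] that by (simp add: R_def a_def)
  have p0: "0 < p" using np by simp
  have ker_a: "cyclotomic_kernel {..<p} a"
    using cyclotomic_kernel.pullback[OF K[of W0], of "{..<p}" id] by (simp add: a_def subset_iff)
  have ker: "cyclotomic_kernel {..<p + 2} (capped p a)"
  proof (rule capped_cyclotomic_kernel[OF ker_a p0 S])
    fix W assume "W \<in> {W. R W = R W0}"
    then have "R W = R W0" by simp
    from K[of W] same[OF this] K_far[of _ W] K_edge[of _ W] K_diag[of _ W]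
    show "\<exists>A. cyclotomic_kernel {..<p + W} A
      \<and> (\<forall>i<p. \<forall>j<p. A i j = a i j)
      \<and> (\<forall>i j. p \<le> j \<longrightarrow> j < p + W \<longrightarrow> i + 1 < j \<longrightarrow> A i j = 0)
      \<and> (\<forall>i<W. cmod (A (p + i - 1) (p + i)) = 1) \<and> (\<forall>i<W. A (p + i) (p + i) = 0)"
      by (intro exI[of _ "K W"]) blast
  qed
  interpret capped: cyclotomic_kernel "{..<p + 2}" "capped p a" by (rule ker)
  have old: "capped p a i j = A $$ (i, j)" if "i < n" "j < n" for i j
    using KA[OF that] that np by (simp add: capped_def a_def)
  have conn: "connected_on {..<p + 2} (capped p a)"
  proof (rule connected_on_extend[OF _ n old])
    show "connected_on {..<n} (\<lambda>i j. A $$ (i, j))"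
      using connected_kernel_of_graph[OF d A] by (simp add: connected_kernel_iff n_def)
    show "capped p a j i = cnj (capped p a i j)" if "i < p + 2" "j < p + 2" for i j
      by (rule capped.herm) (use that in auto)
    show "\<exists>j<i. capped p a i j \<noteq> 0" if i: "n \<le> i" "i < p + 2" for i
    proof (cases "i < p")
      case True
      then obtain j where "j < i" "a i j \<noteq> 0" using K_conn[of i W0] i by (auto simp: a_def)
      then show ?thesis using True by (intro exI[of _ j]) (simp add: capped_def)
    next
      case False
      then have "i = p \<or> i = Suc p" using i by auto
      then show ?thesis using p0 by (intro exI[of _ "p - 1"]) (auto simp: capped_def)
    qed
  qed (use np in auto)
  define B where "B = mat (p + 2) (p + 2) (\<lambda>(i, j). capped p a i j)"
  have B: "B \<in> carrier_mat (p + 2) (p + 2)" by (simp add: B_def)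
  have BE: "B $$ (i, j) = capped p a i j" if "i < p + 2" "j < p + 2" for i j
    using that by (simp add: B_def)
  have "connected_cyclotomic_graph d B"
  proof (rule graph_of_connected_kernel[OF B])
    have "cyclotomic_kernel {..<p + 2} (\<lambda>i j. B $$ (i, j))"
      using ker by (simp add: cyclotomic_kernel_def BE psd_def shifted_def hform_def)
    moreover have "edges {..<p + 2} (\<lambda>i j. B $$ (i, j)) = edges {..<p + 2} (capped p a)"
      by (auto simp: edges_def BE)
    ultimately show "connected_kernel {..<p + 2} (\<lambda>i j. B $$ (i, j))"
      using conn by (simp add: connected_kernel_iff connected_on_def)
    show "B $$ (i, j) \<in> label_set d" if ij: "i < p + 2" "j < p + 2" "i \<noteq> j" for i j
      using K_label[of i W0 j] units_label_set ij by (auto simp: BE capped_def a_def)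
  qed simp
  then show ?thesis
  proof (rule that[of B p])
    show "B $$ (i, j) = A $$ (i, j)" if "i < dim_row A" "j < dim_row A" for i j
      using old[of i j] that np by (simp add: BE n_def)
  qed (use np in \<open>simp_all add: BE capped_def n_def, simp add: B_def\<close>)
qed

text \<open>A walk from \<open>u\<close> to \<open>u'\<close> in \<open>B\<close> embeds into every
  extension \<open>G\<close>, so its length bounds the distance of the caps there, and with it the
  size of \<open>G\<close>, uniformly.\<close>

lemma two_caps_bounded_extensions:
  assumes d: "d < 0" and B: "connected_cyclotomic_graph d B"
    and verts: "{u, v, u', v'} \<subseteq> {..<dim_row B}" "distinct [u, v, u', v']"
    and c1: "B $$ (u, u) = 1" "B $$ (v, v) = 1" "B $$ (u, v) = 1"
    and c2: "B $$ (u', u') = 1" "B $$ (v', v') = 1" "B $$ (u', v') = 1"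
  shows "\<not> unbounded_extensions d B"
proof
  assume unb: "unbounded_extensions d B"
  interpret B: connected_kernel "{..<dim_row B}" "\<lambda>i j. B $$ (i, j)"
    by (rule connected_kernel_of_graph[OF d B])
  have "(u, u') \<in> B.E\<^sup>*" by (rule B.connected) (use verts in auto)
  then obtain k where k: "(u, u') \<in> B.E ^^ k" using rtrancl_imp_relpow by blast
  obtain G where G: "connected_cyclotomic_graph d G" "contained_in B G" "5 * k + 7 < dim_row G"
    using unb unfolding unbounded_extensions_def by blast
  obtain f where f: "inj_on f {..<dim_row B}" "f ` {..<dim_row B} \<subseteq> {..<dim_row G}"
    "\<And>i j. i < dim_row B \<Longrightarrow> j < dim_row B \<Longrightarrow> B $$ (i, j) = G $$ (f i, f j)"
    using contained_inE[OF G(2) graph_square[OF G(1)]] by metis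
  interpret G: connected_kernel "{..<dim_row G}" "\<lambda>i j. G $$ (i, j)"
    by (rule connected_kernel_of_graph[OF d G(1)])
  have fG: "f i < dim_row G" if "i < dim_row B" for i using f(2) that by auto
  have edge: "(f i, f j) \<in> G.E" if "(i, j) \<in> B.E" for i j
    using that fG f(3)[of i j] by (auto simp: edges_def)
  have path: "(f i, f j) \<in> G.E ^^ m" if "(i, j) \<in> B.E ^^ m" for i j m
    using that
  proof (induction m arbitrary: j)
    case (Suc m)
    then obtain l where "(i, l) \<in> B.E ^^ m" "(l, j) \<in> B.E" by auto
    then show ?case using Suc.IH edge by (auto intro: relcompI)
  qed simp
  have ne: "f i \<noteq> f j" if "i < dim_row B" "j < dim_row B" "i \<noteq> j" for i j
    using f(1) that by (auto simp: inj_on_def)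
  have "G.cap (f u) (f v)" "G.cap (f u') (f v')" "{f u, f v} \<inter> {f u', f v'} = {}"
    using verts c1 c2 fG ne by (auto simp: G.cap_def f(3)[symmetric])
  from G.two_caps_card_le[OF this path[OF k]] have "dim_row G \<le> 5 * k + 7" by simp
  then show False using G(3) by simp
qed

theorem theorem8:
  fixes d :: int and A :: "complex mat"
  assumes "d \<in> {-2, -7, -11, -15}"
    and "connected_cyclotomic_graph d A"
  shows "\<exists>G. maximal_graph d G \<and> contained_in A G"
proof (rule ccontr)
  assume none: "\<not> (\<exists>G. maximal_graph d G \<and> contained_in A G)"
  have d: "d < 0" using assms(1) by auto
  note A = assms(2)
  obtain B p where B: "connected_cyclotomic_graph d B" "dim_row A \<le> p" "dim_row B = p + 2"
    "\<And>i j. i < dim_row A \<Longrightarrow> j < dim_row A \<Longrightarrow> B $$ (i, j) = A $$ (i, j)"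
    "B $$ (p, p) = 1" "B $$ (Suc p, Suc p) = 1" "B $$ (p, Suc p) = 1"
    using add_cap[OF d A unbounded_extensions_of_no_maximal[OF A none]] by metis
  have AB: "contained_in A B"
    by (rule contained_inI[where f = id]) (use graph_square[OF A] graph_square[OF B(1)] B(2-4) in auto)
  \<comment> \<open>Lying in no maximal graph is inherited by extensions, so \<open>B\<close> can be
    capped again.\<close>
  have noneB: "\<not> (\<exists>G. maximal_graph d G \<and> contained_in B G)"
    using maximal_extension_mono[OF A B(1) AB] none by blast
  obtain C q where C: "connected_cyclotomic_graph d C" "dim_row B \<le> q" "dim_row C = q + 2"
    "\<And>i j. i < dim_row B \<Longrightarrow> j < dim_row B \<Longrightarrow> C $$ (i, j) = B $$ (i, j)"
    "C $$ (q, q) = 1" "C $$ (Suc q, Suc q) = 1" "C $$ (q, Suc q) = 1"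
    using add_cap[OF d B(1) unbounded_extensions_of_no_maximal[OF B(1) noneB]] by metis
  have BC: "contained_in B C"
    by (rule contained_inI[where f = id]) (use graph_square[OF B(1)] graph_square[OF C(1)] C(2-4) in auto)
  have "\<not> (\<exists>G. maximal_graph d G \<and> contained_in C G)"
    using maximal_extension_mono[OF B(1) C(1) BC] noneB by blast
  then have "unbounded_extensions d C" by (rule unbounded_extensions_of_no_maximal[OF C(1)])
  moreover have "\<not> unbounded_extensions d C"
    by (rule two_caps_bounded_extensions[OF d C(1), where u = p and v = "Suc p" and u' = q and v' = "Suc q"])
      (use B C in auto)
  ultimately show False by contradiction
qed

end
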